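(* Consider the single-agent contract problem with safety inspections described in the context, and suppose that $c_1<\dots<c_n$, $R_1<\dots<R_n$ (Assumption 1) and $\max_i(R_i-c_i)>\kappa_S$ (Assumption 2). Then an optimal linear contract $(\gamma^*,\beta^* )$ can be computed in time $\mathcal O(n\log n)$; that is, there is an algorithm which, given $(R_i,c_i)_{i=1}^n$, $\kappa_S$, $\kappa_I$, $\alpha$, outputs an optimal linear contract in time $\mathcal O(n\log n)$.
   Context: Single-agent model. An agent chooses an action $(a_i,s)$ with $i\in[n]:=\{1,\dots,n\}$ and $s\in\{0,1\}$. Actions with $s=1$ are called safe, actions with $s=0$ unsafe. Effort $a_i$ costs the agent $c_i\ge 0$ and taking $s=1$ costs an additional $\kappa_S\ge 0$. Effort $a_i$ has expected (nonnegative) reward $R_i\ge 0$ for the principal when the action is safe. When the action is unsafe, negative side effects (reward $-\infty$) occur with probability $\alpha\in(0,1]$. A linear contract is a pair $(\gamma,\beta)\in[0,1]^2$: $\gamma$ is the fraction of the reward paid to the agent (nothing is paid if side effects occur), and $\beta$ is the probability of an inspection that reveals $s$ (nothing is paid if the inspection reveals an unsafe action; inspection is independent of side effects). An inspection costs the principal $\kappa_I$. The agent's expected utility under $(\gamma,\beta)$ is $$\mathcal U_a(a_i,1)=\gamma R_i-c_i-\kappa_S,\qquad \mathcal U_a(a_i,0)=(1-\beta)(1-\alpha)\gamma R_i-c_i .$$ The contract $(\gamma,\beta)$ implements the action $(a_i,s)$ if (IC) $\mathcal U_a(a_i,s)\ge \mathcal U_a(a_j,s')$ for all $j\in[n]$,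 $s'\in\{0,1\}$, and (IR) $\mathcal U_a(a_i,s)\ge 0$. If the agent takes the safe action $(a_i,1)$, the principal's expected utility is $\mathcal U_p(a_i,1)=(1-\gamma)R_i-\beta\kappa_I$; for unsafe actions it is $-\infty$. An optimal linear contract is a linear contract that, together with an action it implements, maximizes the principal's expected utility over all pairs consisting of a linear contract $(\gamma,\beta)$ and an action it implements. Time is counted in elementary operations on real numbers (arithmetic operations, comparisons, square roots). *)

theory Defs
  imports "HOL-Analysis.Analysis" "HOL-Library.Extended_Real" "HOL-Library.Landau_Symbols"
begin

section \<open>Contracts with safety inspections\<close>

text \<open>Efforts are numbered from 1 to the number of efforts; rewards and costs at other
  indices are irrelevant.\<close>

record problem =
  efforts :: nat
  reward :: "nat \<Rightarrow> real"
  cost :: "nat \<Rightarrow> real"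
  kappaS :: real
  kappaI :: real
  alpha :: real

definition valid_problem :: "problem \<Rightarrow> bool" where
  "valid_problem p \<longleftrightarrow>
     1 \<le> efforts p \<and>
     (\<forall>i\<in>{1..efforts p}. 0 \<le> reward p i \<and> 0 \<le> cost p i) \<and>
     0 \<le> kappaS p \<and> 0 < alpha p \<and> alpha p \<le> 1"

definition increasing_costs_rewards :: "problem \<Rightarrow> bool" where
  "increasing_costs_rewards p \<longleftrightarrow>
     strict_mono_on {1..efforts p} (cost p) \<and> strict_mono_on {1..efforts p} (reward p)"

definition safety_worthwhile :: "problem \<Rightarrow> bool" where
  "safety_worthwhile p \<longleftrightarrow> (MAX i\<in>{1..efforts p}. reward p i - cost p i) > kappaS p"

text \<open>An action is an effort with a flag that is true iff the action is safe.\<close>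

type_synonym action = "nat \<times> bool"

text \<open>A contract is the pair of the agent's share and the inspection probability.\<close>

type_synonym contract = "real \<times> real"

definition actions :: "problem \<Rightarrow> action set" where
  "actions p = {1..efforts p} \<times> UNIV"

definition linear_contracts :: "contract set" where
  "linear_contracts = {0..1} \<times> {0..1}"

fun agent_utility :: "problem \<Rightarrow> contract \<Rightarrow> action \<Rightarrow> real" where
  "agent_utility p (\<gamma>, \<beta>) (i, safe) =
     (if safe then \<gamma> * reward p i - cost p i - kappaS p
      else (1 - \<beta>) * (1 - alpha p) * \<gamma> * reward p i - cost p i)"

fun principal_utility :: "problem \<Rightarrow> contract \<Rightarrow> action \<Rightarrow> ereal" where
  "principal_utility p (\<gamma>, \<beta>) (i, safe) =
     (if safe then ereal ((1 - \<gamma>) * reward p i - \<beta> * kappaI p) else -\<infinity>)"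

definition implements :: "problem \<Rightarrow> contract \<Rightarrow> action \<Rightarrow> bool" where
  "implements p k a \<longleftrightarrow>
     a \<in> actions p \<and>
     (\<forall>a'\<in>actions p. agent_utility p k a' \<le> agent_utility p k a) \<and>
     0 \<le> agent_utility p k a"

definition optimal_linear_contract :: "problem \<Rightarrow> contract \<Rightarrow> bool" where
  "optimal_linear_contract p k \<longleftrightarrow>
     k \<in> linear_contracts \<and>
     (\<exists>a. implements p k a \<and>
       (\<forall>k'\<in>linear_contracts. \<forall>a'. implements p k' a' \<longrightarrow>
          principal_utility p k' a' \<le> principal_utility p k a))"

section \<open>A real RAM\<close>

text \<open>
  Algorithms are while programs over scalar variables and unbounded arrays, holding real
  numbers or natural numbers. Naturals serve as array indices and counters; there is no
  conversion between the two sorts, and no rounding. Every node of an expression (a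
  constant, a memory access, an arithmetic operation, a comparison or a connective), every
  assignment and every evaluation of a guard takes one unit of time, so the running time
  bounds in particular the number of operations on reals. Only integers occur as real
  constants, so a program is a finite object that carries no hidden real data.

  Subtraction of naturals is truncated. Division by zero and roots of negative numbers
  follow the library conventions; a program can exclude them by a comparison.
\<close>

type_synonym vname = string

record state =
  nvar :: "vname \<Rightarrow> nat"
  narr :: "vname \<Rightarrow> nat \<Rightarrow> nat"
  rvar :: "vname \<Rightarrow> real"
  rarr :: "vname \<Rightarrow> nat \<Rightarrow> real"

datatype nexp =
    NConst nat
  | NVar vname
  | NArr vname nexp
  | NAdd nexp nexp
  | NSub nexp nexp
  | NHalf nexp

datatype rexp =
    RConst int
  | RVar vname
  | RArr vname nexp
  | RAdd rexp rexp
  | RSub rexp rexp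
  | RMul rexp rexp
  | RDiv rexp rexp
  | RSqrt rexp

datatype bexp =
    NLess nexp nexp
  | RLess rexp rexp
  | BNot bexp
  | BAnd bexp bexp

datatype com =
    SKIP
  | NAssign vname nexp
  | NStore vname nexp nexp
  | RAssign vname rexp
  | RStore vname nexp rexp
  | Seq com com
  | Cond bexp com com
  | While bexp com

primrec nval :: "nexp \<Rightarrow> state \<Rightarrow> nat" where
  "nval (NConst k) s = k"
| "nval (NVar x) s = nvar s x"
| "nval (NArr x e) s = narr s x (nval e s)"
| "nval (NAdd e f) s = nval e s + nval f s"
| "nval (NSub e f) s = nval e s - nval f s"
| "nval (NHalf e) s = nval e s div 2"

primrec rval :: "rexp \<Rightarrow> state \<Rightarrow> real" where
  "rval (RConst k) s = real_of_int k"
| "rval (RVar x) s = rvar s x"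
| "rval (RArr x e) s = rarr s x (nval e s)"
| "rval (RAdd e f) s = rval e s + rval f s"
| "rval (RSub e f) s = rval e s - rval f s"
| "rval (RMul e f) s = rval e s * rval f s"
| "rval (RDiv e f) s = rval e s / rval f s"
| "rval (RSqrt e) s = sqrt (rval e s)"

primrec bval :: "bexp \<Rightarrow> state \<Rightarrow> bool" where
  "bval (NLess e f) s \<longleftrightarrow> nval e s < nval f s"
| "bval (RLess e f) s \<longleftrightarrow> rval e s < rval f s"
| "bval (BNot b) s \<longleftrightarrow> \<not> bval b s"
| "bval (BAnd b d) s \<longleftrightarrow> bval b s \<and> bval d s"

primrec ntime :: "nexp \<Rightarrow> nat" where
  "ntime (NConst k) = 1"
| "ntime (NVar x) = 1"
| "ntime (NArr x e) = 1 + ntime e"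
| "ntime (NAdd e f) = 1 + ntime e + ntime f"
| "ntime (NSub e f) = 1 + ntime e + ntime f"
| "ntime (NHalf e) = 1 + ntime e"

primrec rtime :: "rexp \<Rightarrow> nat" where
  "rtime (RConst k) = 1"
| "rtime (RVar x) = 1"
| "rtime (RArr x e) = 1 + ntime e"
| "rtime (RAdd e f) = 1 + rtime e + rtime f"
| "rtime (RSub e f) = 1 + rtime e + rtime f"
| "rtime (RMul e f) = 1 + rtime e + rtime f"
| "rtime (RDiv e f) = 1 + rtime e + rtime f"
| "rtime (RSqrt e) = 1 + rtime e"

primrec btime :: "bexp \<Rightarrow> nat" where
  "btime (NLess e f) = 1 + ntime e + ntime f"
| "btime (RLess e f) = 1 + rtime e + rtime f"
| "btime (BNot b) = 1 + btime b"
| "btime (BAnd b d) = 1 + btime b + btime d"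

text \<open>\<open>exec c s t s'\<close>: started in state \<open>s\<close>, program \<open>c\<close> halts after time \<open>t\<close> in state \<open>s'\<close>.\<close>

inductive exec :: "com \<Rightarrow> state \<Rightarrow> nat \<Rightarrow> state \<Rightarrow> bool" where
  Skip: "exec SKIP s 1 s"
| NAssign: "exec (NAssign x e) s (1 + ntime e)
     (s\<lparr>nvar := (nvar s)(x := nval e s)\<rparr>)"
| NStore: "exec (NStore x d e) s (1 + ntime d + ntime e)
     (s\<lparr>narr := (narr s)(x := (narr s x)(nval d s := nval e s))\<rparr>)"
| RAssign: "exec (RAssign x e) s (1 + rtime e)
     (s\<lparr>rvar := (rvar s)(x := rval e s)\<rparr>)"
| RStore: "exec (RStore x d e) s (1 + ntime d + rtime e)
     (s\<lparr>rarr := (rarr s)(x := (rarr s x)(nval d s := rval e s))\<rparr>)"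
| Seq: "exec c s t s' \<Longrightarrow> exec d s' u s'' \<Longrightarrow> exec (Seq c d) s (t + u) s''"
| CondTrue: "bval b s \<Longrightarrow> exec c s t s' \<Longrightarrow> exec (Cond b c d) s (1 + btime b + t) s'"
| CondFalse: "\<not> bval b s \<Longrightarrow> exec d s t s' \<Longrightarrow> exec (Cond b c d) s (1 + btime b + t) s'"
| WhileFalse: "\<not> bval b s \<Longrightarrow> exec (While b c) s (1 + btime b) s"
| WhileTrue: "bval b s \<Longrightarrow> exec c s t s' \<Longrightarrow> exec (While b c) s' u s'' \<Longrightarrow>
     exec (While b c) s (1 + btime b + t + u) s''"

inductive_cases SkipE: "exec SKIP s t s'"
inductive_cases NAssignE: "exec (NAssign x e) s t s'"
inductive_cases NStoreE: "exec (NStore x d e) s t s'"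
inductive_cases RAssignE: "exec (RAssign x e) s t s'"
inductive_cases RStoreE: "exec (RStore x d e) s t s'"
inductive_cases SeqE: "exec (Seq c d) s t s'"
inductive_cases CondE: "exec (Cond b c d) s t s'"
inductive_cases WhileE: "exec (While b c) s t s'"

lemma exec_deterministic:
  "exec c s t s' \<Longrightarrow> exec c s u s'' \<Longrightarrow> u = t \<and> s'' = s'"
proof (induction arbitrary: u s'' rule: exec.induct)
  case Skip
  then show ?case by (auto elim: SkipE)
next
  case NAssign
  then show ?case by (auto elim: NAssignE)
next
  case NStore
  then show ?case by (auto elim: NStoreE)
next
  case RAssign
  then show ?case by (auto elim: RAssignE)
next
  case RStore
  then show ?case by (auto elim: RStoreE)
next
  case Seq
  from Seq.prems show ?case by (rule SeqE) (metis Seq.IH)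
next
  case CondTrue
  from CondTrue.prems show ?case by (rule CondE) (use CondTrue.hyps(1) in \<open>auto dest!: CondTrue.IH\<close>)
next
  case CondFalse
  from CondFalse.prems show ?case by (rule CondE) (use CondFalse.hyps(1) in \<open>auto dest!: CondFalse.IH\<close>)
next
  case WhileFalse
  from WhileFalse.prems show ?case by (rule WhileE) (use WhileFalse.hyps(1) in auto)
next
  case WhileTrue
  from WhileTrue.prems show ?case by (rule WhileE) (use WhileTrue.hyps(1) in \<open>auto dest!: WhileTrue.IH\<close>)
qed

section \<open>Input and output\<close>

text \<open>Memory holds the input data and is zero elsewhere; in particular it does not expose
  rewards and costs at indices outside the range of efforts.\<close>

definition input_state :: "problem \<Rightarrow> state" where
  "input_state p = \<lparr>
     nvar = (\<lambda>_. 0)(''n'' := efforts p),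
     narr = (\<lambda>_ _. 0),
     rvar = (\<lambda>_. 0)(''kappaS'' := kappaS p, ''kappaI'' := kappaI p, ''alpha'' := alpha p),
     rarr = (\<lambda>_ _. 0)(''R'' := (\<lambda>i. if i \<in> {1..efforts p} then reward p i else 0),
                        ''c'' := (\<lambda>i. if i \<in> {1..efforts p} then cost p i else 0))\<rparr>"

definition output_contract :: "state \<Rightarrow> contract" where
  "output_contract s = (rvar s ''gamma'', rvar s ''beta'')"

end

theory Submission
  imports Defs "HOL-Real_Asymp.Real_Asymp"
begin

text \<open>
  Add the outside option as a line with reward and cost 0, and let \<open>u\<close> be the upper envelope of
  the lines \<open>R j * g - C j\<close>, the agent's utility from the best effort at share \<open>g\<close>. A share \<open>g\<close>
  with \<open>u g \<ge> kappaS\<close> makes the effort of the active segment safe as soon as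
  \<open>u ((1 - \<beta>) * (1 - alpha) * g) \<le> u g - kappaS\<close>. If \<open>g\<close> lies on segment \<open>a\<close> of the envelope and
  the level \<open>u g - kappaS\<close> on segment \<open>b\<close>, the least such \<open>\<beta>\<close> has a closed form, and the
  principal's utility is unimodal in \<open>g\<close> with its peak at a square root or at the point where
  inspections become superfluous, clipped to the cell of \<open>a\<close> and \<open>b\<close>. As the lines come sorted by
  slope, a stack computes the envelope, and a sweep with two pointers visits the nonempty cells,
  both in linear time. A negative \<open>kappaI\<close> makes \<open>\<beta> = 1\<close> and the left end of each cell optimal.
\<close>

section \<open>Running time of loop-free programs and bounded loops\<close>

primrec loop_free :: "com \<Rightarrow> bool" where
  "loop_free SKIP = True"
| "loop_free (NAssign x e) = True"
| "loop_free (NStore x d e) = True"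
| "loop_free (RAssign x e) = True"
| "loop_free (RStore x d e) = True"
| "loop_free (Seq c d) = (loop_free c \<and> loop_free d)"
| "loop_free (Cond b c d) = (loop_free c \<and> loop_free d)"
| "loop_free (While b c) = False"

text \<open>Without loops, execution is a total function of the state. The \<open>While\<close>
  clause is a dummy, since \<open>run\<close> is applied to loop-free programs only.\<close>

primrec run :: "com \<Rightarrow> state \<Rightarrow> state" where
  "run SKIP s = s"
| "run (NAssign x e) s = s\<lparr>nvar := (nvar s)(x := nval e s)\<rparr>"
| "run (NStore x d e) s = s\<lparr>narr := (narr s)(x := (narr s x)(nval d s := nval e s))\<rparr>"
| "run (RAssign x e) s = s\<lparr>rvar := (rvar s)(x := rval e s)\<rparr>"
| "run (RStore x d e) s = s\<lparr>rarr := (rarr s)(x := (rarr s x)(nval d s := rval e s))\<rparr>"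
| "run (Seq c d) s = run d (run c s)"
| "run (Cond b c d) s = (if bval b s then run c s else run d s)"
| "run (While b c) s = s"

primrec time_bound :: "com \<Rightarrow> nat" where
  "time_bound SKIP = 1"
| "time_bound (NAssign x e) = 1 + ntime e"
| "time_bound (NStore x d e) = 1 + ntime d + ntime e"
| "time_bound (RAssign x e) = 1 + rtime e"
| "time_bound (RStore x d e) = 1 + ntime d + rtime e"
| "time_bound (Seq c d) = time_bound c + time_bound d"
| "time_bound (Cond b c d) = 1 + btime b + max (time_bound c) (time_bound d)"
| "time_bound (While b c) = 0"

lemma exec_run: "loop_free c \<Longrightarrow> \<exists>t\<le>time_bound c. exec c s t (run c s)"
proof (induction c arbitrary: s)
  case (Seq c d)
  then obtain t u where "t \<le> time_bound c" "exec c s t (run c s)"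
    "u \<le> time_bound d" "exec d (run c s) u (run d (run c s))"
    by fastforce
  then show ?case
    by (intro exI[of _ "t + u"]) (auto intro: exec.Seq)
next
  case (Cond b c d)
  then obtain t u where *: "t \<le> time_bound c" "exec c s t (run c s)"
    "u \<le> time_bound d" "exec d s u (run d s)"
    by fastforce
  show ?case
  proof (cases "bval b s")
    case True
    with * show ?thesis
      by (intro exI[of _ "1 + btime b + t"] conjI) (auto intro: exec.CondTrue[simplified])
  next
    case False
    with * show ?thesis
      by (intro exI[of _ "1 + btime b + u"] conjI) (auto intro: exec.CondFalse[simplified])
  qed
qed (auto intro: exec.intros[simplified] order_refl)

text \<open>A Hoare triple for total correctness with a time bound that is uniform over all initial
  states satisfying \<open>P\<close>.\<close>

definition halts :: "(state \<Rightarrow> bool) \<Rightarrow> com \<Rightarrow> nat \<Rightarrow> (state \<Rightarrow> bool) \<Rightarrow> bool" where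
  "halts P c T Q \<longleftrightarrow> (\<forall>s. P s \<longrightarrow> (\<exists>t s'. exec c s t s' \<and> t \<le> T \<and> Q s'))"

lemma halts_loop_free:
  assumes "loop_free c" "\<And>s. P s \<Longrightarrow> Q (run c s)"
  shows "halts P c (time_bound c) Q"
  unfolding halts_def using assms exec_run by blast

lemma halts_Seq:
  assumes "halts P c T Q" "halts Q d U A"
  shows "halts P (Seq c d) (T + U) A"
  unfolding halts_def
proof (intro allI impI)
  fix s assume "P s"
  then obtain t s' where 1: "exec c s t s'" "t \<le> T" "Q s'"
    using assms(1) unfolding halts_def by blast
  then obtain u s'' where 2: "exec d s' u s''" "u \<le> U" "A s''"
    using assms(2) unfolding halts_def by blast
  show "\<exists>t s'. exec (Seq c d) s t s' \<and> t \<le> T + U \<and> A s'"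
    using exec.Seq[OF 1(1) 2(1)] 1(2) 2(2,3) by (meson add_mono)
qed

text \<open>Each iteration is paid for by a drop of the measure, so there are at most
  \<open>M\<close> of them; the extra unit in \<open>M + 1\<close> pays for the last, failing
  guard.\<close>

lemma halts_While:
  assumes "loop_free c"
    and step: "\<And>s. P s \<Longrightarrow> bval b s \<Longrightarrow> P (run c s) \<and> m (run c s) < m s"
    and bound: "\<And>s. P s \<Longrightarrow> m s \<le> M"
  shows "halts P (While b c) ((1 + btime b + time_bound c) * (M + 1)) (\<lambda>s. P s \<and> \<not> bval b s)"
proof -
  have "\<exists>t s'. exec (While b c) s t s' \<and> t \<le> (1 + btime b + time_bound c) * (m s + 1)
      \<and> P s' \<and> \<not> bval b s'" if "P s" for s
    using that
  proof (induction "m s" arbitrary: s rule: less_induct)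
    case less
    show ?case
    proof (cases "bval b s")
      case False
      then show ?thesis
        using less.prems exec.WhileFalse[OF False] by (intro exI conjI) auto
    next
      case True
      let ?s = "run c s" and ?K = "1 + btime b + time_bound c"
      from True less.prems step have *: "P ?s" "m ?s < m s" by auto
      from less.hyps[OF *(2,1)] obtain u s' where u: "exec (While b c) ?s u s'"
        "u \<le> ?K * (m ?s + 1)" "P s'" "\<not> bval b s'" by blast
      obtain t where t: "t \<le> time_bound c" "exec c s t ?s"
        using exec_run assms(1) by blast
      have "?K * (m ?s + 1) \<le> ?K * m s" using *(2) by (intro mult_left_mono) auto
      then have "1 + btime b + t + u \<le> ?K * (m s + 1)" using u(2) t(1) by (simp add: algebra_simps)
      with exec.WhileTrue[OF True t(2) u(1)] u(3,4) show ?thesis by blast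
    qed
  qed
  moreover have "(1 + btime b + time_bound c) * (m s + 1) \<le> (1 + btime b + time_bound c) * (M + 1)"
    if "P s" for s
    using bound[OF that] by (intro mult_left_mono) auto
  ultimately show ?thesis
    unfolding halts_def by (meson order_trans)
qed

section \<open>The best share for fixed optimal efforts\<close>

text \<open>For nonnegative arguments, this is the least \<open>\<beta>\<close> in the unit interval
  with \<open>(1 - \<beta>) * w * g \<le> x\<close>. For \<open>K < 0\<close> inspections earn
  money, so inspecting always is best.\<close>

definition inspection :: "real \<Rightarrow> real \<Rightarrow> real \<Rightarrow> real \<Rightarrow> real" where
  "inspection K w g x = (if K < 0 then 1 else if x < w * g then 1 - x / (w * g) else 0)"

text \<open>Junk values are harmless: if \<open>w = 0\<close> or \<open>K < 0\<close>, the square root is at most 0 and, for \<open>lo \<ge> 0\<close>, the result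
  is \<open>lo\<close>, which is optimal as \<open>inspection\<close> is then constant.\<close>

definition best_share :: "real \<Rightarrow> real \<Rightarrow> real \<Rightarrow> real \<Rightarrow> real \<Rightarrow> real \<Rightarrow> real \<Rightarrow> real" where
  "best_share \<rho> r d w K lo hi =
     max lo (min hi (min (sqrt (K * d / (\<rho> * r * w))) (d / (\<rho> - w * r))))"

lemma inspection_in_unit:
  assumes "0 \<le> w" "0 \<le> g" "0 \<le> x"
  shows "0 \<le> inspection K w g x" "inspection K w g x \<le> 1"
  using assms by (auto simp: inspection_def divide_le_eq_1)

lemma inspection_sufficient:
  assumes "0 \<le> w" "0 \<le> g" "0 \<le> x"
  shows "(1 - inspection K w g x) * w * g \<le> x"
  using assms by (auto simp: inspection_def not_less)

lemma inspection_least: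
  assumes "0 \<le> w" "0 \<le> g" "0 \<le> x" "(1 - \<beta>) * w * g \<le> x" "0 \<le> \<beta>" "0 \<le> K"
  shows "inspection K w g x \<le> \<beta>"
proof (cases "x < w * g")
  case True
  then have "0 < w * g" using assms(3) by linarith
  then have "1 - \<beta> \<le> x / (w * g)"
    using assms(4) by (simp add: pos_le_divide_eq mult.assoc)
  with True assms(6) show ?thesis by (simp add: inspection_def)
qed (use assms in \<open>auto simp: inspection_def\<close>)

lemma best_share_in_range:
  assumes "lo \<le> hi"
  shows "lo \<le> best_share \<rho> r d w K lo hi" "best_share \<rho> r d w K lo hi \<le> hi"
  using assms by (auto simp: best_share_def)

text \<open>The difference of the two values has the sign of
  \<open>(h - g) * (A - \<rho> * (g * h))\<close>; comparing one endpoint with the peak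
  \<open>sqrt (A / \<rho>)\<close> compares \<open>g * h\<close> with
  \<open>A / \<rho>\<close>.\<close>

lemma hyperbola_mono:
  fixes A \<rho> g h :: real
  assumes "0 < g" "g \<le> h" "0 < \<rho>" "0 \<le> A"
  shows "h \<le> sqrt (A / \<rho>) \<Longrightarrow> - \<rho> * g - A / g \<le> - \<rho> * h - A / h"
    and "sqrt (A / \<rho>) \<le> g \<Longrightarrow> - \<rho> * h - A / h \<le> - \<rho> * g - A / g"
proof -
  have "0 < h" using assms by linarith
  have eq: "(- \<rho> * h - A / h) - (- \<rho> * g - A / g) = (h - g) * (A - \<rho> * (g * h)) / (g * h)"
    using \<open>0 < g\<close> \<open>0 < h\<close> by (simp add: field_simps)
  have sq: "sqrt (A / \<rho>) * sqrt (A / \<rho>) = A / \<rho>" using assms by simp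
  {
    assume "h \<le> sqrt (A / \<rho>)"
    then have "g * h \<le> sqrt (A / \<rho>) * sqrt (A / \<rho>)"
      using assms \<open>0 < h\<close> by (intro mult_mono) auto
    then have "0 \<le> A - \<rho> * (g * h)" using \<open>0 < \<rho>\<close> sq by (simp add: field_simps)
    then have "0 \<le> (h - g) * (A - \<rho> * (g * h)) / (g * h)"
      using assms \<open>0 < h\<close> by (intro divide_nonneg_pos mult_nonneg_nonneg) auto
    with eq show "- \<rho> * g - A / g \<le> - \<rho> * h - A / h" by linarith
  }
  {
    assume "sqrt (A / \<rho>) \<le> g"
    then have "sqrt (A / \<rho>) * sqrt (A / \<rho>) \<le> g * h"
      using assms by (intro mult_mono) auto
    then have "A - \<rho> * (g * h) \<le> 0" using \<open>0 < \<rho>\<close> sq by (simp add: field_simps)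
    then have "(h - g) * (A - \<rho> * (g * h)) / (g * h) \<le> 0"
      using assms \<open>0 < h\<close> by (intro divide_nonpos_pos mult_nonneg_nonpos) auto
    with eq show "- \<rho> * h - A / h \<le> - \<rho> * g - A / g" by linarith
  }
qed

text \<open>Here \<open>\<rho>\<close> and \<open>r\<close> are the rewards of the safe effort and
  of the tempting unsafe one. For \<open>K \<ge> 0\<close>, \<open>f\<close> follows a hyperbola
  while inspections are needed and then falls linearly, so it is unimodal and its peak only has to
  be clipped to the interval.\<close>

lemma best_share_optimal:
  fixes \<rho> r d w K lo hi g :: real
  defines "f \<equiv> \<lambda>g. (1 - g) * \<rho> - inspection K w g ((\<rho> * g - d) / r) * K"
  assumes "0 < r" "r \<le> \<rho>" "0 \<le> d" "0 \<le> w" "w < 1" "0 \<le> lo" "d \<le> \<rho> * lo" "lo \<le> g" "g \<le> hi"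
  shows "f g \<le> f (best_share \<rho> r d w K lo hi)"
proof (cases "K < 0")
  case True
  have "K * d / (\<rho> * r * w) \<le> 0"
    using True assms by (intro divide_nonpos_nonneg mult_nonpos_nonneg mult_nonneg_nonneg) auto
  then have "sqrt (K * d / (\<rho> * r * w)) \<le> 0" by simp
  then have "best_share \<rho> r d w K lo hi = lo"
    using assms unfolding best_share_def by linarith
  then show ?thesis using True assms by (simp add: f_def inspection_def)
next
  case False
  define z where "z = d / (\<rho> - w * r)"
  define p where "p = sqrt (K * d / (\<rho> * r * w))"
  define A where "A = K * d / (r * w)"
  define C where "C = \<rho> - K * (1 - \<rho> / (r * w))"
  have pA: "p = sqrt (A / \<rho>)" by (simp add: p_def A_def mult_ac)
  have "w * r < \<rho>" using assms by (smt (verit) mult_less_cancel_right2)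
  have "0 \<le> z" using assms \<open>w * r < \<rho>\<close> by (simp add: z_def)
  have "0 \<le> A" using assms False by (simp add: A_def)
  have iff: "(\<rho> * h - d) / r < w * h \<longleftrightarrow> h < z" for h
    using \<open>0 < r\<close> \<open>w * r < \<rho>\<close> by (simp add: z_def field_simps)
  have late: "f h = (1 - h) * \<rho>" if "z \<le> h" for h
    using that False iff[of h] by (simp add: f_def inspection_def)
  \<comment> \<open>The endpoint \<open>z\<close> is included, as both branches agree there; this
    lets monotonicity pass from one branch to the other.\<close>
  have early: "f h = C - \<rho> * h - A / h" if "0 < w" "0 < h" "h \<le> z" for h
  proof -
    have "inspection K w h ((\<rho> * h - d) / r) = 1 - (\<rho> * h - d) / r / (w * h)"
    proof (cases "h < z")
      case True
      then show ?thesis using False iff[of h] by (simp add: inspection_def)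
    next
      case h: False
      with that(3) have "h = z" by simp
      then have "(\<rho> * h - d) / r = w * h"
        using \<open>0 < r\<close> \<open>w * r < \<rho>\<close> by (simp add: z_def field_simps)
      then show ?thesis using that False iff[of h] h by (simp add: inspection_def)
    qed
    then have "f h = (1 - h) * \<rho> - (1 - (\<rho> * h - d) / r / (w * h)) * K"
      by (simp only: f_def)
    also have "\<dots> = C - \<rho> * h - A / h"
      using that \<open>0 < r\<close> by (simp add: C_def A_def field_simps)
    finally show ?thesis .
  qed
  \<comment> \<open>Left of \<open>z\<close> the nonnegative threshold is below
    \<open>w * h\<close>, which excludes the cases \<open>w = 0\<close> and \<open>h = 0\<close>
    where the hyperbola is meaningless.\<close>
  have pos: "0 < h \<and> 0 < w" if "lo \<le> h" "h < z" for h
  proof -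
    have "0 \<le> (\<rho> * h - d) / r" using assms that by (smt (verit) divide_nonneg_pos mult_left_mono)
    then have "0 < w * h" using that(2) iff[of h] by linarith
    then show ?thesis using assms that by (simp add: zero_less_mult_iff)
  qed
  have up: "f h \<le> f h'" if "lo \<le> h" "h \<le> h'" "h' \<le> p" "h' \<le> z" for h h'
  proof (cases "h < z")
    case True
    with pos that have "0 < h" "0 < w" by blast+
    with that early hyperbola_mono(1)[of h h' \<rho> A] assms \<open>0 \<le> A\<close> pA show ?thesis by simp
  next
    case F: False
    with that have "h = h'" by linarith
    then show ?thesis by simp
  qed
  \<comment> \<open>The way from \<open>h'\<close> to \<open>h\<close> is split at
    \<open>min h z\<close>: first the hyperbola, then the linear branch.\<close>
  have down: "f h \<le> f h'" if "lo \<le> h'" "h' \<le> h" "min p z \<le> h'" for h h'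
  proof (cases "h' < z")
    case True
    with pos that have "0 < h'" "0 < w" by blast+
    have "f (min h z) \<le> f h'"
      using that True early hyperbola_mono(2)[of h' "min h z" \<rho> A] assms \<open>0 \<le> A\<close> pA \<open>0 < h'\<close> \<open>0 < w\<close>
      by (auto simp: min_def split: if_splits)
    moreover have "f h \<le> f (min h z)"
      using late[of h] late[of z] assms by (auto simp: min_def)
    ultimately show ?thesis by linarith
  next
    case F: False
    have "(1 - h) * \<rho> \<le> (1 - h') * \<rho>"
      using that assms(2,3) by (intro mult_right_mono) auto
    with F show ?thesis using late[of h] late[of h'] that by linarith
  qed
  \<comment> \<open>Shares left of the clipped peak are handled by \<open>up\<close>, shares right
    of it by \<open>down\<close>.\<close>
  show ?thesis
    using up down assms unfolding best_share_def p_def[symmetric] z_def[symmetric]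
    by (smt (verit))
qed

section \<open>Upper envelopes of lines\<close>

definition line :: "(nat \<Rightarrow> real) \<Rightarrow> (nat \<Rightarrow> real) \<Rightarrow> nat \<Rightarrow> real \<Rightarrow> real" where
  "line R C j g = R j * g - C j"

text \<open>\<open>S\<close> lists the lines from the bottom to the top of a stack, and at
  \<open>B l\<close> the line \<open>S l\<close> takes over from its predecessor. Only neighbours
  are compared; domination by the active segment follows by telescoping.\<close>

definition line_chain ::
  "(nat \<Rightarrow> real) \<Rightarrow> (nat \<Rightarrow> real) \<Rightarrow> nat \<Rightarrow> (nat \<Rightarrow> nat) \<Rightarrow> (nat \<Rightarrow> real) \<Rightarrow> bool" where
  "line_chain R C k S B \<longleftrightarrow> S 0 = 0 \<and> B 0 = -1 \<and>
     (\<forall>l<k. S l < S (Suc l) \<and> R (S l) < R (S (Suc l)) \<and> B l < B (Suc l) \<and> 0 \<le> B (Suc l) \<and>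
        line R C (S l) (B (Suc l)) = line R C (S (Suc l)) (B (Suc l)))"

lemma line_chain_prefix: "line_chain R C k S B \<Longrightarrow> l \<le> k \<Longrightarrow> line_chain R C l S B"
  by (auto simp: line_chain_def)

lemma line_chain_push:
  assumes "line_chain R C k S B" "S k < i" "R (S k) < R i" "B k < x" "0 \<le> x"
    "line R C (S k) x = line R C i x"
  shows "line_chain R C (Suc k) (S(Suc k := i)) (B(Suc k := x))"
  using assms by (auto simp: line_chain_def less_Suc_eq)

lemma line_crossing:
  assumes "R i < R j" "x = (C j - C i) / (R j - R i)"
  shows "line R C i x = line R C j x"
  using assms by (simp add: line_def field_simps)

lemma line_after_crossing:
  assumes "R i \<le> R j" "line R C i x = line R C j x"
  shows "x \<le> g \<Longrightarrow> line R C i g \<le> line R C j g" "g \<le> x \<Longrightarrow> line R C j g \<le> line R C i g"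
proof -
  have "line R C j g - line R C i g = (R j - R i) * (g - x)"
    using assms(2) by (simp add: line_def algebra_simps)
  then show "x \<le> g \<Longrightarrow> line R C i g \<le> line R C j g" "g \<le> x \<Longrightarrow> line R C j g \<le> line R C i g"
    using assms(1) by (smt (verit) mult_nonneg_nonneg mult_nonneg_nonpos)+
qed

context
  fixes R C k S B
  assumes chain: "line_chain R C k S B"
begin

lemma chain_step:
  assumes "l < k"
  shows "S l < S (Suc l)" "R (S l) < R (S (Suc l))" "B l < B (Suc l)" "0 \<le> B (Suc l)"
    "line R C (S l) (B (Suc l)) = line R C (S (Suc l)) (B (Suc l))"
  using chain assms by (auto simp: line_chain_def)

lemma chain_mono:
  assumes "l \<le> m" "m \<le> k"
  shows "S l \<le> S m" "R (S l) \<le> R (S m)" "B l \<le> B m" "l < m \<Longrightarrow> S l < S m"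
    "l < m \<Longrightarrow> R (S l) < R (S m)"
proof -
  have "S l \<le> S m \<and> R (S l) \<le> R (S m) \<and> B l \<le> B m \<and> (l < m \<longrightarrow> S l < S m \<and> R (S l) < R (S m))"
    using assms
  proof (induction rule: dec_induct)
    case (step m)
    then show ?case using chain_step[of m] by (auto simp: less_Suc_eq)
  qed simp
  then show "S l \<le> S m" "R (S l) \<le> R (S m)" "B l \<le> B m" "l < m \<Longrightarrow> S l < S m"
    "l < m \<Longrightarrow> R (S l) < R (S m)" by auto
qed

text \<open>Line indices grow strictly from 0; this bounds the number of segments by the number of
  efforts.\<close>

lemma chain_size: "l \<le> k \<Longrightarrow> l \<le> S l"
proof (induction l)
  case (Suc l)
  then show ?case using chain_step(1)[of l] by simp
qed simp

text \<open>As \<open>B\<close> increases, all crossings from \<open>l\<close> up to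
  \<open>m\<close> lie at or left of \<open>g\<close>, so each line is below its successor there.
  \<open>chain_left\<close> is the mirror image.\<close>

lemma chain_right:
  assumes "l \<le> m" "m \<le> k" "B m \<le> g"
  shows "line R C (S l) g \<le> line R C (S m) g"
  using assms
proof (induction rule: dec_induct)
  case (step m)
  then have "m < k" by simp
  from chain_step[OF this] step show ?case
    using line_after_crossing(1)[of R "S m" "S (Suc m)" C "B (Suc m)" g] by simp
qed simp

lemma chain_left:
  assumes "m \<le> l" "l \<le> k" "g \<le> B (Suc m)"
  shows "line R C (S l) g \<le> line R C (S m) g"
  using assms
proof (induction rule: dec_induct)
  case (step l)
  then have "l < k" "B (Suc m) \<le> B (Suc l)" using chain_mono(3)[of "Suc m" "Suc l"] by auto
  with chain_step[of l] step show ?case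
    using line_after_crossing(2)[of R "S l" "S (Suc l)" C "B (Suc l)" g] by simp
qed simp

end

section \<open>Implementable safe actions\<close>

locale contract_problem =
  fixes p :: problem
  assumes valid: "valid_problem p"
    and increasing: "increasing_costs_rewards p"
    and worthwhile: "safety_worthwhile p"
begin

text \<open>Index 0, where the input arrays are zero, plays the outside option.\<close>

definition R :: "nat \<Rightarrow> real" where
  "R i = (if i \<in> {1..efforts p} then reward p i else 0)"

definition C :: "nat \<Rightarrow> real" where
  "C i = (if i \<in> {1..efforts p} then cost p i else 0)"

abbreviation L :: "nat \<Rightarrow> real \<Rightarrow> real" where
  "L \<equiv> line R C"

definition w :: real where
  "w = 1 - alpha p"

definition feasible :: "real \<Rightarrow> real \<Rightarrow> nat \<Rightarrow> bool" where
  "feasible g \<beta> i \<longleftrightarrow> (g, \<beta>) \<in> linear_contracts \<and> implements p (g, \<beta>) (i, True)"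

definition payoff :: "real \<Rightarrow> real \<Rightarrow> nat \<Rightarrow> real" where
  "payoff g \<beta> i = (1 - g) * R i - \<beta> * kappaI p"

lemma efforts_pos: "1 \<le> efforts p"
  and R_nonneg: "0 \<le> R i"
  and C_nonneg: "0 \<le> C i"
  and kappaS_nonneg: "0 \<le> kappaS p"
  and w_range: "0 \<le> w" "w < 1"
  using valid by (auto simp: valid_problem_def R_def C_def w_def)

lemma zero_line [simp]: "L 0 g = 0"
  by (simp add: line_def R_def C_def)

lemma R_strict: "1 \<le> i \<Longrightarrow> i < j \<Longrightarrow> j \<le> efforts p \<Longrightarrow> R i < R j"
  and C_strict: "1 \<le> i \<Longrightarrow> i < j \<Longrightarrow> j \<le> efforts p \<Longrightarrow> C i < C j"
  using increasing by (auto simp: increasing_costs_rewards_def strict_mono_on_def R_def C_def)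

lemma C_mono:
  assumes "i \<le> j" "j \<le> efforts p"
  shows "C i \<le> C j"
proof (cases "i = 0")
  case True
  then show ?thesis using C_nonneg[of j] by (simp add: C_def)
next
  case False
  then show ?thesis using C_strict[of i j] assms by (cases "i = j") auto
qed

text \<open>Among safe actions \<open>kappaS\<close> cancels, and unsafe deviations evaluate the
  same lines at the reduced share \<open>(1 - \<beta>) * w * g\<close>. Incentive compatibility thus
  involves the envelope at two points only.\<close>

lemma feasible_iff:
  "feasible g \<beta> i \<longleftrightarrow> 0 \<le> g \<and> g \<le> 1 \<and> 0 \<le> \<beta> \<and> \<beta> \<le> 1 \<and> i \<in> {1..efforts p} \<and>
     (\<forall>j\<in>{1..efforts p}. L j g \<le> L i g) \<and>
     (\<forall>j\<in>{1..efforts p}. L j ((1 - \<beta>) * w * g) \<le> L i g - kappaS p) \<and>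
     kappaS p \<le> L i g"
proof -
  have R: "reward p j = R j" and C: "cost p j = C j" if "j \<in> {1..efforts p}" for j
    using that by (simp_all add: R_def C_def)
  have all: "(\<forall>a'\<in>actions p. P a') \<longleftrightarrow> (\<forall>j\<in>{1..efforts p}. P (j, True)) \<and> (\<forall>j\<in>{1..efforts p}. P (j, False))"
    for P
    by (auto simp: actions_def UNIV_bool)
  show ?thesis
    unfolding feasible_def implements_def all
    by (auto simp: linear_contracts_def actions_def R C w_def line_def mult_ac)
qed

lemma principal_utility_payoff:
  "i \<in> {1..efforts p} \<Longrightarrow> principal_utility p (g, \<beta>) (i, True) = ereal (payoff g \<beta> i)"
  by (auto simp: payoff_def R_def)

lemma full_share_feasible:
  obtains i where "feasible 1 1 i" "kappaS p = 0 \<Longrightarrow> feasible 1 0 i" "0 < R i"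
proof -
  let ?N = "{1..efforts p}"
  have "(MAX i\<in>?N. reward p i - cost p i) \<in> (\<lambda>i. reward p i - cost p i) ` ?N"
    using efforts_pos by (intro Max_in) auto
  then obtain i where i: "i \<in> ?N" "(MAX i\<in>?N. reward p i - cost p i) = reward p i - cost p i"
    by blast
  have max: "L j 1 \<le> L i 1" if "j \<in> ?N" for j
  proof -
    have "reward p j - cost p j \<le> (MAX i\<in>?N. reward p i - cost p i)"
      using that by (intro Max_ge) auto
    then show ?thesis using i that by (simp add: line_def R_def C_def)
  qed
  have gt: "kappaS p < L i 1"
    using worthwhile i by (simp add: safety_worthwhile_def line_def R_def C_def)
  have "L j 0 \<le> L i 1 - kappaS p" for j
    using C_nonneg[of j] gt by (simp add: line_def)
  then have "feasible 1 1 i"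
    using i max gt by (auto simp: feasible_iff)
  moreover have "feasible 1 0 i" if "kappaS p = 0"
  proof -
    have "L j w \<le> L j 1" for j
      using w_range R_nonneg[of j] by (simp add: line_def mult_left_le)
    then have "L j w \<le> L i 1" if "j \<in> {1..efforts p}" for j
      using max[OF that] order_trans by blast
    then show ?thesis
      using i max gt that by (simp add: feasible_iff)
  qed
  moreover have "0 < R i"
    using gt kappaS_nonneg C_nonneg[of i] by (simp add: line_def)
  ultimately show ?thesis using that by blast
qed

text \<open>An effort without reward is implementable only if safety is free; then paying out the
  whole reward is at least as good.\<close>

lemma zero_reward_dominated:
  assumes "feasible g \<beta> i" "R i = 0"
  obtains \<beta>' i' where "feasible 1 \<beta>' i'" "0 < R i'" "payoff g \<beta> i \<le> payoff 1 \<beta>' i'"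
proof -
  obtain i' where i': "feasible 1 1 i'" "kappaS p = 0 \<Longrightarrow> feasible 1 0 i'" "0 < R i'"
    using full_share_feasible by blast
  have "kappaS p = 0" and \<beta>: "0 \<le> \<beta>" "\<beta> \<le> 1"
    using assms kappaS_nonneg C_nonneg[of i] by (auto simp: feasible_iff line_def)
  show ?thesis
  proof (cases "0 \<le> kappaI p")
    case True
    with that[of 0 i'] i' \<open>kappaS p = 0\<close> \<beta> assms(2) show ?thesis by (simp add: payoff_def)
  next
    case False
    with that[of 1 i'] i' \<beta> assms(2) show ?thesis
      by (auto simp: payoff_def mult_le_cancel_right2)
  qed
qed

text \<open>Unsafe actions give the principal \<open>-\<infinity>\<close> and safe ones without
  reward are dominated, so comparing with safe actions of positive reward suffices.\<close>

lemma optimalI: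
  assumes "feasible g \<beta> i"
    and best: "\<And>g' \<beta>' i'. feasible g' \<beta>' i' \<Longrightarrow> 0 < R i' \<Longrightarrow> payoff g' \<beta>' i' \<le> payoff g \<beta> i"
  shows "optimal_linear_contract p (g, \<beta>)"
proof -
  have all: "payoff g' \<beta>' i' \<le> payoff g \<beta> i" if f: "feasible g' \<beta>' i'" for g' \<beta>' i'
  proof (cases "R i' = 0")
    case True
    obtain \<beta>'' i'' where "feasible 1 \<beta>'' i''" "0 < R i''" "payoff g' \<beta>' i' \<le> payoff 1 \<beta>'' i''"
      using zero_reward_dominated[OF f True] by blast
    then show ?thesis using best order_trans by blast
  next
    case False
    then show ?thesis using best[OF f] R_nonneg[of i'] by simp
  qed
  have "principal_utility p k' a' \<le> principal_utility p (g, \<beta>) (i, True)"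
    if k': "k' \<in> linear_contracts" and a': "implements p k' a'" for k' a'
  proof -
    obtain g' \<beta>' i' safe where eq: "k' = (g', \<beta>')" "a' = (i', safe)" by (metis surj_pair)
    show ?thesis
    proof (cases safe)
      case True
      with k' a' eq have "feasible g' \<beta>' i'" by (simp add: feasible_def)
      with all assms(1) eq True show ?thesis
        by (simp add: principal_utility_payoff feasible_iff del: principal_utility.simps)
    qed (simp add: eq)
  qed
  then show ?thesis
    using assms(1) unfolding optimal_linear_contract_def feasible_def by blast
qed

end

section \<open>Cells of the envelope\<close>

text \<open>The sentinel \<open>B (Suc k)\<close> exceeds 1, so that the last segment covers the share 1.\<close>

locale contract_envelope = contract_problem +
  fixes k :: nat and S :: "nat \<Rightarrow> nat" and B :: "nat \<Rightarrow> real"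
  assumes chain: "line_chain R C k S B"
    and top: "S k \<le> efforts p"
    and dominant: "j \<le> efforts p \<Longrightarrow> 0 \<le> g \<Longrightarrow> \<exists>l\<le>k. L j g \<le> L (S l) g"
    and last_B: "B (Suc k) = B k + 2"
begin

text \<open>If the outside option were the whole envelope, no effort would have a positive surplus
  at share 1, against \<open>worthwhile\<close>.\<close>

lemma k_pos: "1 \<le> k"
proof (rule ccontr)
  assume "\<not> 1 \<le> k"
  then have "k = 0" by simp
  have "(MAX i\<in>{1..efforts p}. reward p i - cost p i) \<le> 0"
  proof (subst Max_le_iff)
    have "L j 1 \<le> 0" if "j \<le> efforts p" for j
      using dominant[OF that, of 1] \<open>k = 0\<close> chain by (auto simp: line_chain_def)
    then show "\<forall>a\<in>(\<lambda>i. reward p i - cost p i) ` {1..efforts p}. a \<le> 0"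
      by (fastforce simp: line_def R_def C_def)
  qed (use efforts_pos in auto)
  then show False using worthwhile kappaS_nonneg by (simp add: safety_worthwhile_def)
qed

lemma B_step: "l \<le> k \<Longrightarrow> B l < B (Suc l)"
  using chain_step(3)[OF chain, of l] last_B by (cases "l = k") auto

lemma B_nonneg: "1 \<le> l \<Longrightarrow> l \<le> k \<Longrightarrow> 0 \<le> B l"
  using chain_step(4)[OF chain, of "l - 1"] by simp

lemma S_range:
  assumes "1 \<le> l" "l \<le> k"
  shows "S l \<in> {1..efforts p}"
proof -
  have "S 0 = 0" using chain by (simp add: line_chain_def)
  then show ?thesis
    using chain_mono(4)[OF chain, of 0 l] chain_mono(1)[OF chain, of l k] top assms by auto
qed

lemma R_pos:
  assumes "1 \<le> l" "l \<le> k"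
  shows "0 < R (S l)"
proof -
  have "S 0 = 0" using chain by (simp add: line_chain_def)
  then show ?thesis
    using chain_mono(5)[OF chain, of 0 l] R_nonneg[of 0] assms by auto
qed

text \<open>\<open>dominant\<close> gives some line of the chain above line \<open>j\<close>, and
  telescoping from either side leads from it to the active segment.\<close>

lemma envelope:
  assumes "m \<le> k" "0 \<le> g" "B m \<le> g" "g \<le> B (Suc m)" "j \<le> efforts p"
  shows "L j g \<le> L (S m) g"
proof -
  obtain l where l: "l \<le> k" "L j g \<le> L (S l) g" using dominant assms by blast
  have "L (S l) g \<le> L (S m) g"
    using chain_right[OF chain, of l m g] chain_left[OF chain, of m l g] l assms
    by (cases "l \<le> m") auto
  with l show ?thesis by simp
qed

text \<open>At \<open>B 1\<close> the envelope is still 0, so a line of positive slope is negative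
  further left and the agent would not participate. The sweep may therefore start at the first
  segment.\<close>

lemma feasible_first_segment:
  assumes "feasible g \<beta> i" "0 < R i"
  shows "B 1 \<le> g"
proof (rule ccontr)
  assume "\<not> B 1 \<le> g"
  have B: "0 \<le> B 1" "B 0 = -1" "S 0 = 0"
    using B_nonneg k_pos chain by (auto simp: line_chain_def)
  then have "L i (B 1) \<le> 0"
    using envelope[of 0 "B 1" i] assms k_pos by (auto simp: feasible_iff)
  moreover have "0 \<le> L i g" using assms kappaS_nonneg by (auto simp: feasible_iff)
  ultimately have "R i * B 1 \<le> R i * g" by (simp add: line_def)
  with \<open>\<not> B 1 \<le> g\<close> assms(2) show False by simp
qed

text \<open>A share belongs to the cell of \<open>a\<close> and \<open>b\<close> if \<open>S a\<close> is the best safe effort, and if \<open>S b\<close>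
  is the best unsafe effort at the reduced share where deviating is just not profitable.\<close>

definition cell :: "nat \<Rightarrow> nat \<Rightarrow> real \<Rightarrow> bool" where
  "cell a b g \<longleftrightarrow> 0 \<le> g \<and> g \<le> 1 \<and> B a \<le> g \<and> g \<le> B (Suc a) \<and>
     L (S b) (B b) + kappaS p \<le> L (S a) g \<and> L (S a) g \<le> L (S b) (B (Suc b)) + kappaS p"

text \<open>The reduced share at which the unsafe effort \<open>S b\<close> earns as much as the
  safe effort \<open>S a\<close> at share \<open>g\<close>, with \<open>kappaS\<close>
  deducted.\<close>

definition threshold :: "nat \<Rightarrow> nat \<Rightarrow> real \<Rightarrow> real" where
  "threshold a b g = (R (S a) * g - (C (S a) + kappaS p - C (S b))) / R (S b)"

lemma line_threshold:
  assumes "1 \<le> b" "b \<le> k"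
  shows "L (S b) (threshold a b g) = L (S a) g - kappaS p"
  using R_pos[OF assms] by (simp add: threshold_def line_def)

lemma cell_threshold:
  assumes "cell a b g" "1 \<le> b" "b \<le> k"
  shows "B b \<le> threshold a b g" "threshold a b g \<le> B (Suc b)" "0 \<le> threshold a b g"
proof -
  have "R (S b) * B b \<le> R (S b) * threshold a b g"
    "R (S b) * threshold a b g \<le> R (S b) * B (Suc b)"
    using assms(1) line_threshold[OF assms(2,3), of a g] by (auto simp: cell_def line_def)
  then show "B b \<le> threshold a b g" "threshold a b g \<le> B (Suc b)"
    using R_pos[OF assms(2,3)] by simp_all
  with B_nonneg[OF assms(2,3)] show "0 \<le> threshold a b g" by simp
qed

lemma L_mono: "g \<le> h \<Longrightarrow> L j g \<le> L j h"
  using R_nonneg[of j] by (simp add: line_def mult_left_mono)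

text \<open>All lines are nondecreasing, so unsafe deviations need checking only at the threshold,
  which lies on segment \<open>b\<close> of the envelope.\<close>

lemma cell_feasible:
  assumes "cell a b g" "1 \<le> a" "a \<le> k" "1 \<le> b" "b \<le> k" "0 \<le> \<beta>" "\<beta> \<le> 1"
    and y: "(1 - \<beta>) * w * g \<le> threshold a b g"
  shows "feasible g \<beta> (S a)"
proof -
  have g: "0 \<le> g" "g \<le> 1" "B a \<le> g" "g \<le> B (Suc a)" using assms(1) by (auto simp: cell_def)
  note x = cell_threshold[OF assms(1,4,5)]
  have "0 \<le> L (S b) (B b)"
    using envelope[of b "B b" 0] B_nonneg[of b] B_step[of b] assms by simp
  then have "kappaS p \<le> L (S a) g" using assms(1) by (auto simp: cell_def)
  moreover have "L j ((1 - \<beta>) * w * g) \<le> L (S a) g - kappaS p" if "j \<le> efforts p" for j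
  proof -
    have "L j ((1 - \<beta>) * w * g) \<le> L j (threshold a b g)" using y by (rule L_mono)
    also have "\<dots> \<le> L (S b) (threshold a b g)" using x that assms by (intro envelope) auto
    finally show ?thesis using line_threshold assms by simp
  qed
  moreover have "L j g \<le> L (S a) g" if "j \<le> efforts p" for j
    using g that assms by (intro envelope) auto
  ultimately show ?thesis
    using g assms S_range by (auto simp: feasible_iff)
qed

text \<open>A feasible effort attains the envelope at \<open>g\<close>. A steeper line through that
  point would exceed the envelope at \<open>B (Suc a)\<close>, which is strictly to the
  right.\<close>

lemma cell_bound:
  assumes f: "feasible g \<beta> i" and "1 \<le> a" "a \<le> k" "B a \<le> g" "g < B (Suc a)"
  shows "L i g = L (S a) g" "R i \<le> R (S a)"
proof -
  have i: "i \<in> {1..efforts p}" "0 \<le> g" using f by (auto simp: feasible_iff)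
  show eq: "L i g = L (S a) g"
  proof (rule antisym)
    show "L i g \<le> L (S a) g" using i assms by (intro envelope) auto
    show "L (S a) g \<le> L i g" using f S_range assms by (auto simp: feasible_iff)
  qed
  have "L i (B (Suc a)) \<le> L (S a) (B (Suc a))" using i assms by (intro envelope) auto
  with eq have "R i * (B (Suc a) - g) \<le> R (S a) * (B (Suc a) - g)"
    by (simp add: line_def algebra_simps)
  with assms(5) show "R i \<le> R (S a)" by simp
qed

definition cell_share :: "nat \<Rightarrow> nat \<Rightarrow> real \<Rightarrow> real \<Rightarrow> real" where
  "cell_share a b lo hi =
     best_share (R (S a)) (R (S b)) (C (S a) + kappaS p - C (S b)) w (kappaI p) lo hi"

definition cell_inspection :: "nat \<Rightarrow> nat \<Rightarrow> real \<Rightarrow> real" where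
  "cell_inspection a b g = inspection (kappaI p) w g (threshold a b g)"

lemma cell_inspection_feasible:
  assumes "cell a b g" "1 \<le> a" "a \<le> k" "1 \<le> b" "b \<le> k"
  shows "feasible g (cell_inspection a b g) (S a)"
proof -
  have "0 \<le> g" "0 \<le> threshold a b g"
    using assms cell_threshold[OF assms(1,4,5)] by (auto simp: cell_def)
  then show ?thesis
    using assms w_range cell_feasible[of a b g] unfolding cell_inspection_def
    by (simp add: inspection_in_unit inspection_sufficient)
qed

text \<open>The contract is improved in two steps: first the effort and the inspection probability
  at the same share, then the share.\<close>

lemma cell_dominates:
  assumes ab: "1 \<le> b" "b \<le> a" "a \<le> k"
    and lohi: "cell a b lo" "lo \<le> g" "g \<le> hi"
    and f: "feasible g \<beta> i" and g: "cell a b g" "g < B (Suc a)"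
  shows "payoff g \<beta> i \<le>
    payoff (cell_share a b lo hi) (cell_inspection a b (cell_share a b lo hi)) (S a)"
proof -
  let ?d = "C (S a) + kappaS p - C (S b)"
  have bounds: "0 \<le> g" "g \<le> 1" "B a \<le> g" using g by (auto simp: cell_def)
  note i = cell_bound[OF f _ ab(3) bounds(3) g(2)]
  have i': "L i g = L (S a) g" "R i \<le> R (S a)" using i ab by auto
  have \<beta>: "0 \<le> \<beta>" "\<beta> \<le> 1" using f by (auto simp: feasible_iff)
  have x: "0 \<le> threshold a b g" using cell_threshold[OF g(1)] ab by simp
  have insp: "cell_inspection a b g * kappaI p \<le> \<beta> * kappaI p"
  proof (cases "kappaI p < 0")
    case True
    then show ?thesis
      using \<beta> by (simp add: cell_inspection_def inspection_def mult_le_cancel_right2)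
  next
    case False
    \<comment> \<open>As \<open>i\<close> earns the same as \<open>S a\<close>, the constraint
      against the unsafe effort \<open>S b\<close> alone already forces the inspection probability
      of the cell.\<close>
    have "S b \<in> {1..efforts p}" using S_range ab by simp
    then have "L (S b) ((1 - \<beta>) * w * g) \<le> L (S b) (threshold a b g)"
      using f i' line_threshold[of b a g] ab by (auto simp: feasible_iff)
    then have "(1 - \<beta>) * w * g \<le> threshold a b g"
      using R_pos[of b] ab by (simp add: line_def)
    then have "cell_inspection a b g \<le> \<beta>"
      unfolding cell_inspection_def
      using False \<beta> x bounds w_range by (intro inspection_least) auto
    with False show ?thesis by (simp add: mult_right_mono)
  qed
  have "(1 - g) * R i \<le> (1 - g) * R (S a)" using i' bounds by (intro mult_left_mono) auto
  with insp have "payoff g \<beta> i \<le> payoff g (cell_inspection a b g) (S a)"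
    by (simp add: payoff_def)
  also have "\<dots> \<le> payoff (cell_share a b lo hi) (cell_inspection a b (cell_share a b lo hi)) (S a)"
  proof -
    \<comment> \<open>The order \<open>b \<le> a\<close> enters here and in the comparison of
      rewards below: the unsafe effort is at most as costly and as rewarding as the safe
      one.\<close>
    have "0 \<le> ?d"
      using C_mono[of "S b" "S a"] chain_mono(1)[OF chain, of b a] S_range[of a] ab kappaS_nonneg
      by simp
    moreover have "?d \<le> R (S a) * lo"
      using cell_threshold(3)[OF lohi(1)] R_pos[of b] ab
      by (simp add: threshold_def zero_le_divide_iff)
    moreover have "R (S b) \<le> R (S a)" using chain_mono(2)[OF chain] ab by simp
    moreover have "0 \<le> lo" using lohi by (simp add: cell_def)
    ultimately show ?thesis
      using best_share_optimal[of "R (S b)" "R (S a)" ?d w lo g hi "kappaI p"]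
        R_pos[of b] ab w_range lohi
      by (simp add: payoff_def cell_share_def cell_inspection_def threshold_def)
  qed
  finally show ?thesis .
qed

end

section \<open>Building the envelope\<close>

context contract_problem
begin

lemma R_pos_from:
  assumes "1 < i \<or> 0 < R 1" "1 \<le> i" "i \<le> efforts p"
  shows "0 < R i"
proof (cases "i = 1")
  case False
  then have "R 1 < R i" using R_strict[of 1 i] assms by simp
  then show ?thesis using R_nonneg[of 1] by simp
qed (use assms in auto)

text \<open>A line below \<open>i\<close> may also be dominated by the pending line
  \<open>i\<close>. This alternative makes pops sound, and it vanishes once all efforts are
  processed.\<close>

definition stack_inv :: "nat \<Rightarrow> nat \<Rightarrow> (nat \<Rightarrow> nat) \<Rightarrow> (nat \<Rightarrow> real) \<Rightarrow> bool" where
  "stack_inv i k S B \<longleftrightarrow> 1 \<le> i \<and> i \<le> efforts p + 1 \<and> (1 < i \<or> 0 < R 1) \<and> S k < i \<and>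
     line_chain R C k S B \<and>
     (\<forall>j<i. \<forall>g\<ge>0. (\<exists>l\<le>k. L j g \<le> L (S l) g) \<or> i \<le> efforts p \<and> L j g \<le> L i g)"

text \<open>A first effort without reward has a constant nonpositive line, which the outside option
  covers.\<close>

lemma stack_init:
  assumes "S 0 = 0" "B 0 = -1"
  shows "stack_inv (if 0 < R 1 then 1 else 2) 0 S B"
proof -
  have "L j g \<le> 0" if "j < 2" "\<not> 0 < R 1" "0 \<le> g" for j g
  proof (cases "j = 0")
    case False
    with that have "R j = 0" using R_nonneg[of 1] by (simp add: less_2_cases_iff)
    then show ?thesis using C_nonneg[of j] by (simp add: line_def)
  qed simp
  then show ?thesis
    using efforts_pos assms by (auto simp: stack_inv_def line_chain_def)
qed

lemma stack_dominant:
  assumes "stack_inv i k S B" "j < i" "0 \<le> g"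
  shows "(\<exists>l\<le>k. L j g \<le> L (S l) g) \<or> L j g \<le> L i g"
  using assms unfolding stack_inv_def by blast

text \<open>Distinct slopes make the crossing with the pending line well defined. The outside option
  has slope 0, so at the bottom the pending reward has to be positive.\<close>

lemma stack_top_less:
  assumes "stack_inv i k S B" "i \<le> efforts p"
  shows "R (S k) < R i"
proof (cases "S k = 0")
  case True
  then have "R (S k) = 0" by (simp add: R_def)
  then show ?thesis using R_pos_from[of i] assms by (simp add: stack_inv_def)
next
  case False
  then show ?thesis using R_strict[of "S k" i] assms by (simp add: stack_inv_def)
qed

lemma stack_crossing:
  assumes "stack_inv i k S B" "i \<le> efforts p"
  shows "L (S k) ((C i - C (S k)) / (R i - R (S k))) = L i ((C i - C (S k)) / (R i - R (S k)))"
    "0 \<le> (C i - C (S k)) / (R i - R (S k))"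
  using stack_top_less[OF assms] line_crossing[of R "S k" i] C_mono[of "S k" i] assms
  by (auto simp: stack_inv_def)

text \<open>The pending line joins the stack, so domination by it becomes domination by the
  stack.\<close>

lemma stack_push:
  assumes inv: "stack_inv i k S B" and i: "i \<le> efforts p"
    and x: "x = (C i - C (S k)) / (R i - R (S k))" "B k < x"
  shows "stack_inv (Suc i) (Suc k) (S(Suc k := i)) (B(Suc k := x))"
proof -
  have "line_chain R C (Suc k) (S(Suc k := i)) (B(Suc k := x))"
    using inv x stack_top_less[OF inv i] stack_crossing[OF inv i]
    by (intro line_chain_push) (auto simp: stack_inv_def)
  moreover have "\<exists>l\<le>Suc k. L j g \<le> L ((S(Suc k := i)) l) g" if "j < Suc i" "0 \<le> g" for j g
  proof (cases "j = i")
    case False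
    with that have "j < i" by simp
    with that inv have "(\<exists>l\<le>k. L j g \<le> L (S l) g) \<or> L j g \<le> L i g"
      by (intro stack_dominant)
    then show ?thesis
    proof
      assume "\<exists>l\<le>k. L j g \<le> L (S l) g"
      then obtain l where "l \<le> k" "L j g \<le> L (S l) g" by blast
      then show ?thesis by (intro exI[of _ l]) auto
    next
      assume "L j g \<le> L i g"
      then show ?thesis by (intro exI[of _ "Suc k"]) auto
    qed
  qed (auto intro: exI[of _ "Suc k"])
  ultimately show ?thesis using inv i by (auto simp: stack_inv_def)
qed

text \<open>Left of \<open>B k\<close> the line on top of the stack lies below its predecessor, right of it below
  the new line, as these two cross at \<open>x\<close>. The sentinel \<open>B 0 = -1\<close> protects the bottom.\<close>

lemma stack_pop:
  assumes inv: "stack_inv i k S B" and i: "i \<le> efforts p"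
    and x: "x = (C i - C (S k)) / (R i - R (S k))" "\<not> B k < x"
  shows "0 < k" "stack_inv i (k - 1) S B"
proof -
  have chain: "line_chain R C k S B" using inv by (simp add: stack_inv_def)
  note cross = stack_crossing[OF inv i, folded x(1)]
  show "0 < k"
    using chain x cross(2) by (cases "k = 0") (auto simp: line_chain_def)
  then obtain m where m: "k = Suc m" using gr0_implies_Suc by blast
  have "L (S k) g \<le> L (S m) g \<or> L (S k) g \<le> L i g" for g
  proof (cases "g \<le> B k")
    case True
    then show ?thesis
      using chain_left[OF chain, of m k g] m by simp
  next
    case False
    then show ?thesis
      using line_after_crossing(1)[OF less_imp_le[OF stack_top_less[OF inv i]] cross(1), of g] x
      by simp
  qed
  then have *: "(\<exists>l\<le>m. L (S k) g \<le> L (S l) g) \<or> L (S k) g \<le> L i g" for g by blast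
  have "(\<exists>l\<le>m. L j g \<le> L (S l) g) \<or> L j g \<le> L i g" if "j < i" "0 \<le> g" for j g
  proof -
    have "(\<exists>l\<le>k. L j g \<le> L (S l) g) \<or> L j g \<le> L i g"
      using inv that by (intro stack_dominant)
    then have "(\<exists>l\<le>m. L j g \<le> L (S l) g) \<or> L j g \<le> L i g \<or> L j g \<le> L (S k) g"
      using m le_Suc_eq by metis
    with * show ?thesis by (meson order_trans)
  qed
  moreover have "S m < i"
    using chain_step(1)[OF chain, of m] inv m by (simp add: stack_inv_def)
  ultimately show "stack_inv i (k - 1) S B"
    using inv m i line_chain_prefix[OF chain, of m] by (simp add: stack_inv_def)
qed

lemma stack_final:
  assumes "stack_inv i k S B" "\<not> i < efforts p + 1"
  shows "contract_envelope p k S (B(Suc k := B k + 2))"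
proof
  have i: "i = Suc (efforts p)" using assms by (simp add: stack_inv_def)
  show "line_chain R C k S (B(Suc k := B k + 2))"
    using assms(1) by (auto simp: stack_inv_def line_chain_def)
  show "S k \<le> efforts p" using assms(1) i by (auto simp: stack_inv_def)
  show "\<exists>l\<le>k. L j g \<le> L (S l) g" if "j \<le> efforts p" "0 \<le> g" for j g
    using assms(1) i that by (auto simp: stack_inv_def)
qed simp

lemma stack_size: "stack_inv i k S B \<Longrightarrow> k < i"
  using chain_size[of R C k S B k] by (auto simp: stack_inv_def)

end

section \<open>Sweeping the cells\<close>

context contract_envelope
begin

lemma size: "k \<le> efforts p"
  using chain_size[OF chain, of k] top by simp

text \<open>The comparisons with \<open>g\<close> are strict since at the right end of a segment the next effort is
  optimal as well and has a larger reward.\<close>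

definition sweep_inv :: "nat \<Rightarrow> nat \<Rightarrow> real \<Rightarrow> real \<Rightarrow> real \<Rightarrow> bool" where
  "sweep_inv a b \<gamma> \<beta> v \<longleftrightarrow> 1 \<le> b \<and> b \<le> a \<and> b \<le> k \<and> a \<le> k + 1 \<and>
     (\<exists>i. feasible \<gamma> \<beta> i \<and> v = payoff \<gamma> \<beta> i) \<and>
     (\<forall>g \<beta>' i. feasible g \<beta>' i \<longrightarrow> 0 < R i \<longrightarrow>
        g < B a \<or> L i g < L (S b) (B b) + kappaS p \<longrightarrow> payoff g \<beta>' i \<le> v)"

definition cell_lo :: "nat \<Rightarrow> nat \<Rightarrow> real" where
  "cell_lo a b = max (B a) ((L (S b) (B b) + kappaS p + C (S a)) / R (S a))"

text \<open>The share at which the agent's utility from \<open>S a\<close>, net of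
  \<open>kappaS\<close>, reaches the value of line \<open>S b\<close> at the right end of its
  segment.\<close>

definition cell_end :: "nat \<Rightarrow> nat \<Rightarrow> real" where
  "cell_end a b = (L (S b) (B (Suc b)) + kappaS p + C (S a)) / R (S a)"

definition cell_hi :: "nat \<Rightarrow> nat \<Rightarrow> real" where
  "cell_hi a b = min 1 (min (B (Suc a)) (cell_end a b))"

lemma cell_iff:
  assumes "1 \<le> a" "a \<le> k"
  shows "cell a b g \<longleftrightarrow> cell_lo a b \<le> g \<and> g \<le> cell_hi a b"
  using R_pos[OF assms] B_nonneg[OF assms]
  by (auto simp: cell_def cell_lo_def cell_hi_def cell_end_def line_def field_simps)

text \<open>The envelope is 0 at \<open>B 1\<close>, and feasible actions with positive reward need
  a share of at least \<open>B 1\<close>. No contract has been passed yet, so any feasible incumbent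
  will do.\<close>

lemma sweep_init: "sweep_inv 1 1 1 1 (- kappaI p)"
proof -
  obtain i where i: "feasible 1 1 i" using full_share_feasible by blast
  have "L (S 1) (B 1) = 0"
    using chain_step(5)[OF chain, of 0] k_pos chain by (simp add: line_chain_def)
  then have "\<not> g < B 1 \<and> \<not> L j g < L (S 1) (B 1) + kappaS p" if "feasible g \<beta> j" "0 < R j" for g \<beta> j
    using feasible_first_segment[OF that] that(1) by (auto simp: feasible_iff)
  then show ?thesis
    unfolding sweep_inv_def using i k_pos by (auto simp: payoff_def)
qed

lemma sweep_final:
  assumes "sweep_inv a b \<gamma> \<beta> v" "\<not> a < k + 1"
  shows "optimal_linear_contract p (\<gamma>, \<beta>)"
proof -
  have a: "a = Suc k" using assms by (simp add: sweep_inv_def)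
  have "1 < B (Suc k)" using last_B B_nonneg[of k] k_pos by simp
  then have "payoff g \<beta>' i \<le> v" if "feasible g \<beta>' i" "0 < R i" for g \<beta>' i
    using assms(1) that a by (auto simp: sweep_inv_def feasible_iff)
  then show ?thesis using assms(1) optimalI by (auto simp: sweep_inv_def)
qed

text \<open>As the share grows, the pointer whose segment ends first moves on.\<close>

definition next_cell :: "nat \<Rightarrow> nat \<Rightarrow> nat \<times> nat" where
  "next_cell a b = (if cell_end a b < B (Suc a) then (a, Suc b) else (Suc a, b))"

text \<open>For \<open>b = a\<close>, as \<open>kappaS\<close> is nonnegative, the level
  \<open>L (S a) g - kappaS p\<close> cannot reach the end of the segment before \<open>g\<close>
  does. So \<open>b\<close> never overtakes \<open>a\<close>.\<close>

lemma next_cell_range: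
  assumes "1 \<le> b" "b \<le> a" "a \<le> k" "next_cell a b = (a', b')"
  shows "1 \<le> b' \<and> b' \<le> a' \<and> b' \<le> k \<and> a' \<le> k + 1"
proof -
  have "B (Suc a) \<le> cell_end a a"
    using R_pos[of a] kappaS_nonneg assms by (simp add: cell_end_def line_def field_simps)
  then have "cell_end a b < B (Suc a) \<Longrightarrow> b \<noteq> a" by auto
  then show ?thesis using assms by (auto simp: next_cell_def split: if_splits)
qed

text \<open>Contracts passed by this move but not earlier lie in the cell just left, so optimizing
  over that cell misses none.\<close>

lemma next_cell_covers:
  assumes ab: "1 \<le> b" "b \<le> a" "a \<le> k" and n: "next_cell a b = (a', b')"
    and f: "feasible g \<beta> i"
    and new: "g < B a' \<or> L i g < L (S b') (B b') + kappaS p"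
    and old: "\<not> (g < B a \<or> L i g < L (S b) (B b) + kappaS p)"
  shows "cell a b g" "g < B (Suc a)"
proof -
  have g: "0 \<le> g" "g \<le> 1" and i: "L (S a) g \<le> L i g"
    using f S_range[of a] ab by (auto simp: feasible_iff)
  have "1 \<le> a" using ab by simp
  note Ra = R_pos[OF this ab(3)]
  have *: "g < B (Suc a) \<and> L (S a) g \<le> L (S b) (B (Suc b)) + kappaS p"
  proof (cases "cell_end a b < B (Suc a)")
    case True
    then have n': "a' = a" "b' = Suc b" using n by (auto simp: next_cell_def)
    \<comment> \<open>This makes the corner at \<open>B (Suc b)\<close> a true crossing of two lines
      and not the sentinel.\<close>
    then have "b < k" using next_cell_range[OF ab n] by simp
    then have corner: "L (S b') (B b') = L (S b) (B (Suc b))"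
      using chain_step(5)[OF chain, of b] n' by simp
    with new old n' i have lt: "L (S a) g < L (S b) (B (Suc b)) + kappaS p" by auto
    have "L (S b) (B (Suc b)) + kappaS p < L (S a) (B (Suc a))"
      using True Ra by (simp add: cell_end_def line_def field_simps)
    with lt have "g < B (Suc a)" using L_mono[of "B (Suc a)" g "S a"] by linarith
    with lt show ?thesis by simp
  next
    case False
    then have "a' = Suc a" "b' = b" using n by (auto simp: next_cell_def)
    then have lt: "g < B (Suc a)" using new old by simp
    moreover have "L (S a) g \<le> L (S a) (B (Suc a))" using lt by (intro L_mono) simp
    moreover have "L (S a) (B (Suc a)) \<le> L (S b) (B (Suc b)) + kappaS p"
      using False Ra by (simp add: cell_end_def line_def field_simps)
    ultimately show ?thesis by simp
  qed
  then show "g < B (Suc a)" by simp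
  have "L i g = L (S a) g"
    using cell_bound(1)[OF f] old * ab by simp
  then show "cell a b g" using * old g by (simp add: cell_def)
qed

text \<open>A contract covered afterwards either was covered before or lies in the current cell,
  where \<open>cell_dominates\<close> applies. An empty cell shows up as \<open>hi < lo\<close> and
  leaves the incumbent unchanged.\<close>

lemma sweep_next:
  assumes inv: "sweep_inv a b \<gamma> \<beta> v" and a: "a < k + 1" and n: "next_cell a b = (a', b')"
    and upd: "lo = cell_lo a b" "hi = cell_hi a b" "g = cell_share a b lo hi"
      "y = cell_inspection a b g" "u = (1 - g) * R (S a) - y * kappaI p"
    and new: "(\<gamma>', \<beta>', v') = (if lo \<le> hi \<and> v < u then (g, y, u) else (\<gamma>, \<beta>, v))"
  shows "sweep_inv a' b' \<gamma>' \<beta>' v'"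
proof -
  have ab: "1 \<le> b" "b \<le> a" "a \<le> k" "1 \<le> a" "b \<le> k" using inv a by (auto simp: sweep_inv_def)
  note cell_iff = cell_iff[OF ab(4,3), of b, folded upd]
  have u: "u = payoff g y (S a)" by (simp add: payoff_def upd)
  have "feasible g y (S a)" if "lo \<le> hi"
  proof -
    have "cell a b g" using best_share_in_range[OF that] cell_iff by (simp add: upd cell_share_def)
    then show ?thesis using cell_inspection_feasible ab upd by simp
  qed
  then have inc: "\<exists>i. feasible \<gamma>' \<beta>' i \<and> v' = payoff \<gamma>' \<beta>' i"
    using inv new u by (auto simp: sweep_inv_def split: if_splits)
  have v': "v \<le> v'" "lo \<le> hi \<Longrightarrow> u \<le> v'" using new by (auto split: if_splits)
  have "payoff h \<beta>'' i \<le> v'"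
    if f: "feasible h \<beta>'' i" "0 < R i" and h: "h < B a' \<or> L i h < L (S b') (B b') + kappaS p"
    for h \<beta>'' i
  proof (cases "h < B a \<or> L i h < L (S b) (B b) + kappaS p")
    case True
    then have "payoff h \<beta>'' i \<le> v" using inv f by (auto simp: sweep_inv_def)
    with v' show ?thesis by simp
  next
    case False
    note c = next_cell_covers[OF ab(1-3) n f(1) h False]
    then have lohi: "lo \<le> h" "h \<le> hi" using cell_iff by auto
    then have "cell a b lo" using cell_iff by simp
    then have "payoff h \<beta>'' i \<le> u"
      using cell_dominates[OF ab(1-3) _ lohi f(1) c] u upd by simp
    with v' lohi show ?thesis by simp
  qed
  then show ?thesis
    using next_cell_range[OF ab(1-3) n] inc unfolding sweep_inv_def by blast
qed

end

section \<open>The program\<close>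

abbreviation seq :: "com \<Rightarrow> com \<Rightarrow> com" (infixr ";;" 60) where
  "c ;; d \<equiv> Seq c d"

text \<open>A first effort without reward is skipped: its line is parallel to the outside option.\<close>

definition init_stack :: com where
  "init_stack =
     RStore ''B'' (NConst 0) (RConst (-1)) ;;
     Cond (RLess (RConst 0) (RArr ''R'' (NConst 1)))
       (NAssign ''i'' (NConst 1)) (NAssign ''i'' (NConst 2))"

definition stack_step :: com where
  "stack_step =
     RAssign ''x'' (RDiv
       (RSub (RArr ''c'' (NVar ''i'')) (RArr ''c'' (NArr ''S'' (NVar ''k''))))
       (RSub (RArr ''R'' (NVar ''i'')) (RArr ''R'' (NArr ''S'' (NVar ''k''))))) ;;
     Cond (RLess (RArr ''B'' (NVar ''k'')) (RVar ''x''))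
       (NAssign ''k'' (NAdd (NVar ''k'') (NConst 1)) ;;
        NStore ''S'' (NVar ''k'') (NVar ''i'') ;;
        RStore ''B'' (NVar ''k'') (RVar ''x'') ;;
        NAssign ''i'' (NAdd (NVar ''i'') (NConst 1)))
       (NAssign ''k'' (NSub (NVar ''k'') (NConst 1)))"

definition init_sweep :: com where
  "init_sweep =
     RStore ''B'' (NAdd (NVar ''k'') (NConst 1)) (RAdd (RArr ''B'' (NVar ''k'')) (RConst 2)) ;;
     NAssign ''a'' (NConst 1) ;;
     NAssign ''b'' (NConst 1) ;;
     RAssign ''gamma'' (RConst 1) ;;
     RAssign ''beta'' (RConst 1) ;;
     RAssign ''best'' (RSub (RConst 0) (RVar ''kappaI''))"

definition sweep_lower :: com where
  "sweep_lower =
     RAssign ''ra'' (RArr ''R'' (NArr ''S'' (NVar ''a''))) ;;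
     RAssign ''ca'' (RArr ''c'' (NArr ''S'' (NVar ''a''))) ;;
     RAssign ''rb'' (RArr ''R'' (NArr ''S'' (NVar ''b''))) ;;
     RAssign ''cb'' (RArr ''c'' (NArr ''S'' (NVar ''b''))) ;;
     RAssign ''lo'' (RDiv (RAdd (RAdd (RSub (RMul (RVar ''rb'') (RArr ''B'' (NVar ''b'')))
       (RVar ''cb'')) (RVar ''kappaS'')) (RVar ''ca'')) (RVar ''ra'')) ;;
     Cond (RLess (RVar ''lo'') (RArr ''B'' (NVar ''a'')))
       (RAssign ''lo'' (RArr ''B'' (NVar ''a''))) SKIP"

text \<open>The pointers advance here, before the cell is optimized; later fragments read only
  cached scalars. After incrementing \<open>a\<close>, the entry of \<open>B\<close> at
  \<open>a\<close> is the right end of the old segment.\<close>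

definition sweep_upper :: com where
  "sweep_upper =
     RAssign ''hi'' (RDiv (RAdd (RAdd (RSub (RMul (RVar ''rb'')
       (RArr ''B'' (NAdd (NVar ''b'') (NConst 1)))) (RVar ''cb'')) (RVar ''kappaS''))
       (RVar ''ca'')) (RVar ''ra'')) ;;
     Cond (RLess (RVar ''hi'') (RArr ''B'' (NAdd (NVar ''a'') (NConst 1))))
       (NAssign ''b'' (NAdd (NVar ''b'') (NConst 1)))
       (NAssign ''a'' (NAdd (NVar ''a'') (NConst 1)) ;;
        RAssign ''hi'' (RArr ''B'' (NVar ''a''))) ;;
     Cond (RLess (RConst 1) (RVar ''hi'')) (RAssign ''hi'' (RConst 1)) SKIP"

definition sweep_share :: com where
  "sweep_share =
     RAssign ''d'' (RSub (RAdd (RVar ''ca'') (RVar ''kappaS'')) (RVar ''cb'')) ;;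
     RAssign ''w'' (RSub (RConst 1) (RVar ''alpha'')) ;;
     RAssign ''g'' (RSqrt (RDiv (RMul (RVar ''kappaI'') (RVar ''d''))
       (RMul (RMul (RVar ''ra'') (RVar ''rb'')) (RVar ''w'')))) ;;
     RAssign ''z'' (RDiv (RVar ''d'') (RSub (RVar ''ra'') (RMul (RVar ''w'') (RVar ''rb'')))) ;;
     Cond (RLess (RVar ''z'') (RVar ''g'')) (RAssign ''g'' (RVar ''z'')) SKIP ;;
     Cond (RLess (RVar ''hi'') (RVar ''g'')) (RAssign ''g'' (RVar ''hi'')) SKIP ;;
     Cond (RLess (RVar ''g'') (RVar ''lo'')) (RAssign ''g'' (RVar ''lo'')) SKIP"

definition sweep_inspection :: com where
  "sweep_inspection =
     RAssign ''x'' (RDiv (RSub (RMul (RVar ''ra'') (RVar ''g'')) (RVar ''d'')) (RVar ''rb'')) ;;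
     Cond (RLess (RVar ''kappaI'') (RConst 0))
       (RAssign ''y'' (RConst 1))
       (Cond (RLess (RVar ''x'') (RMul (RVar ''w'') (RVar ''g'')))
         (RAssign ''y'' (RSub (RConst 1) (RDiv (RVar ''x'') (RMul (RVar ''w'') (RVar ''g'')))))
         (RAssign ''y'' (RConst 0))) ;;
     RAssign ''u'' (RSub (RMul (RSub (RConst 1) (RVar ''g'')) (RVar ''ra''))
       (RMul (RVar ''y'') (RVar ''kappaI'')))"

definition sweep_update :: com where
  "sweep_update =
     Cond (RLess (RVar ''best'') (RVar ''u''))
       (RAssign ''gamma'' (RVar ''g'') ;; RAssign ''beta'' (RVar ''y'') ;;
        RAssign ''best'' (RVar ''u'')) SKIP"

definition sweep_step :: com where
  "sweep_step = sweep_lower ;; sweep_upper ;;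
     Cond (RLess (RVar ''hi'') (RVar ''lo'')) SKIP (sweep_share ;; sweep_inspection ;; sweep_update)"

definition stack_guard :: bexp where
  "stack_guard = NLess (NVar ''i'') (NAdd (NVar ''n'') (NConst 1))"

definition sweep_guard :: bexp where
  "sweep_guard = NLess (NVar ''a'') (NAdd (NVar ''k'') (NConst 1))"

definition contract_prog :: com where
  "contract_prog = init_stack ;; While stack_guard stack_step ;; init_sweep ;;
     While sweep_guard sweep_step"

lemmas prog_defs = init_stack_def stack_step_def init_sweep_def sweep_lower_def sweep_upper_def
  sweep_share_def
  sweep_inspection_def sweep_update_def sweep_step_def

lemma loop_free_parts: "loop_free init_stack" "loop_free stack_step" "loop_free init_sweep"
  "loop_free sweep_step"
  by (simp_all add: prog_defs)

section \<open>Effect of the program fragments on memory\<close>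

lemma select_if:
  "nvar (if b then s else s') = (if b then nvar s else nvar s')"
  "narr (if b then s else s') = (if b then narr s else narr s')"
  "rvar (if b then s else s') = (if b then rvar s else rvar s')"
  "rarr (if b then s else s') = (if b then rarr s else rarr s')"
  by simp_all

lemma run_sweep_lower:
  "nvar (run sweep_lower s) = nvar s" "narr (run sweep_lower s) = narr s"
  "rarr (run sweep_lower s) = rarr s"
  "x \<notin> {''ra'', ''ca'', ''rb'', ''cb'', ''lo''} \<Longrightarrow> rvar (run sweep_lower s) x = rvar s x"
  "rvar (run sweep_lower s) ''ra'' = rarr s ''R'' (narr s ''S'' (nvar s ''a''))"
  "rvar (run sweep_lower s) ''ca'' = rarr s ''c'' (narr s ''S'' (nvar s ''a''))"
  "rvar (run sweep_lower s) ''rb'' = rarr s ''R'' (narr s ''S'' (nvar s ''b''))"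
  "rvar (run sweep_lower s) ''cb'' = rarr s ''c'' (narr s ''S'' (nvar s ''b''))"
  "rvar (run sweep_lower s) ''lo'' = max (rarr s ''B'' (nvar s ''a''))
     ((rarr s ''R'' (narr s ''S'' (nvar s ''b'')) * rarr s ''B'' (nvar s ''b'')
       - rarr s ''c'' (narr s ''S'' (nvar s ''b'')) + rvar s ''kappaS''
       + rarr s ''c'' (narr s ''S'' (nvar s ''a''))) / rarr s ''R'' (narr s ''S'' (nvar s ''a'')))"
  by (simp_all add: sweep_lower_def select_if max_def)

lemma run_sweep_upper:
  fixes s
  defines "e \<equiv> (rvar s ''rb'' * rarr s ''B'' (Suc (nvar s ''b'')) - rvar s ''cb''
    + rvar s ''kappaS'' + rvar s ''ca'') / rvar s ''ra''"
  shows "narr (run sweep_upper s) = narr s" "rarr (run sweep_upper s) = rarr s"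
    "x \<notin> {''a'', ''b''} \<Longrightarrow> nvar (run sweep_upper s) x = nvar s x"
    "x \<noteq> ''hi'' \<Longrightarrow> rvar (run sweep_upper s) x = rvar s x"
    "(nvar (run sweep_upper s) ''a'', nvar (run sweep_upper s) ''b'') =
      (if e < rarr s ''B'' (Suc (nvar s ''a'')) then (nvar s ''a'', Suc (nvar s ''b''))
       else (Suc (nvar s ''a''), nvar s ''b''))"
    "rvar (run sweep_upper s) ''hi'' = min 1 (min (rarr s ''B'' (Suc (nvar s ''a''))) e)"
  by (simp_all add: sweep_upper_def select_if min_def flip: e_def)

lemma run_sweep_share:
  "nvar (run sweep_share s) = nvar s" "narr (run sweep_share s) = narr s"
  "rarr (run sweep_share s) = rarr s"
  "x \<notin> {''d'', ''w'', ''g'', ''z''} \<Longrightarrow> rvar (run sweep_share s) x = rvar s x"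
  "rvar (run sweep_share s) ''w'' = 1 - rvar s ''alpha''"
  "rvar (run sweep_share s) ''d'' = rvar s ''ca'' + rvar s ''kappaS'' - rvar s ''cb''"
  "rvar (run sweep_share s) ''g'' = best_share (rvar s ''ra'') (rvar s ''rb'')
     (rvar s ''ca'' + rvar s ''kappaS'' - rvar s ''cb'') (1 - rvar s ''alpha'')
     (rvar s ''kappaI'') (rvar s ''lo'') (rvar s ''hi'')"
  by (auto simp: sweep_share_def best_share_def select_if max_def min_def)

lemma run_sweep_inspection:
  "nvar (run sweep_inspection s) = nvar s" "narr (run sweep_inspection s) = narr s"
  "rarr (run sweep_inspection s) = rarr s"
  "x \<notin> {''x'', ''y'', ''u''} \<Longrightarrow> rvar (run sweep_inspection s) x = rvar s x"
  "rvar (run sweep_inspection s) ''y'' = inspection (rvar s ''kappaI'') (rvar s ''w'') (rvar s ''g'')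
     ((rvar s ''ra'' * rvar s ''g'' - rvar s ''d'') / rvar s ''rb'')"
  "rvar (run sweep_inspection s) ''u'' =
     (1 - rvar s ''g'') * rvar s ''ra'' - rvar (run sweep_inspection s) ''y'' * rvar s ''kappaI''"
  by (auto simp: sweep_inspection_def inspection_def select_if)

lemma run_sweep_update:
  "nvar (run sweep_update s) = nvar s" "narr (run sweep_update s) = narr s"
  "rarr (run sweep_update s) = rarr s"
  "x \<notin> {''gamma'', ''beta'', ''best''} \<Longrightarrow> rvar (run sweep_update s) x = rvar s x"
  "(rvar (run sweep_update s) ''gamma'', rvar (run sweep_update s) ''beta'',
     rvar (run sweep_update s) ''best'') =
   (if rvar s ''best'' < rvar s ''u'' then (rvar s ''g'', rvar s ''y'', rvar s ''u'')
    else (rvar s ''gamma'', rvar s ''beta'', rvar s ''best''))"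
  by (auto simp: sweep_update_def select_if)

section \<open>Invariants in memory and correctness of the two loops\<close>

context contract_problem
begin

definition holds_input :: "state \<Rightarrow> bool" where
  "holds_input s \<longleftrightarrow> nvar s ''n'' = efforts p \<and> rarr s ''R'' = R \<and> rarr s ''c'' = C \<and>
     rvar s ''kappaS'' = kappaS p \<and> rvar s ''kappaI'' = kappaI p \<and> rvar s ''alpha'' = alpha p"

definition stack_state :: "state \<Rightarrow> bool" where
  "stack_state s \<longleftrightarrow> holds_input s \<and>
     stack_inv (nvar s ''i'') (nvar s ''k'') (narr s ''S'') (rarr s ''B'')"

definition sweep_state :: "state \<Rightarrow> bool" where
  "sweep_state s \<longleftrightarrow> holds_input s \<and>
     contract_envelope p (nvar s ''k'') (narr s ''S'') (rarr s ''B'') \<and>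
     contract_envelope.sweep_inv p (nvar s ''k'') (narr s ''S'') (rarr s ''B'')
       (nvar s ''a'') (nvar s ''b'') (rvar s ''gamma'') (rvar s ''beta'') (rvar s ''best'')"

lemma input_state_holds: "holds_input (input_state p)"
  by (auto simp: holds_input_def input_state_def R_def C_def)

lemma init_stack_correct:
  "halts (\<lambda>s. s = input_state p) init_stack (time_bound init_stack) stack_state"
proof (rule halts_loop_free)
  fix s assume s: "s = input_state p"
  let ?B = "(rarr s ''B'')(0 := -1)"
  \<comment> \<open>Zeroed memory already represents the stack that holds only the outside
    option.\<close>
  have "nvar s ''k'' = 0" "narr s ''S'' 0 = 0" by (simp_all add: s input_state_def)
  moreover have "rarr s ''R'' = R" using input_state_holds s by (simp add: holds_input_def)
  moreover have "stack_inv (if 0 < R 1 then 1 else 2) 0 (narr s ''S'') ?B"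
    using calculation by (intro stack_init) auto
  ultimately show "stack_state (run init_stack s)"
    using input_state_holds s
    by (auto simp: stack_state_def holds_input_def init_stack_def)
qed (simp add: loop_free_parts)

text \<open>A push lowers the number of pending efforts and raises \<open>k\<close>, a pop lowers
  \<open>k\<close>. Counting pending efforts twice makes the measure drop in both cases.\<close>

lemma stack_step_correct:
  assumes "stack_state s" "bval stack_guard s"
  shows "stack_state (run stack_step s)"
    "2 * (efforts p + 1 - nvar (run stack_step s) ''i'') + nvar (run stack_step s) ''k''
      < 2 * (efforts p + 1 - nvar s ''i'') + nvar s ''k''"
proof -
  define i k S B where "i = nvar s ''i''" and "k = nvar s ''k''" and "S = narr s ''S''"
    and "B = rarr s ''B''"
  define x where "x = (C i - C (S k)) / (R i - R (S k))"
  note defs = i_def k_def S_def B_def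
  have inv: "stack_inv i k S B" and input: "holds_input s"
    using assms(1) by (simp_all add: stack_state_def defs)
  have i: "i \<le> efforts p" using assms(2) input by (simp add: stack_guard_def holds_input_def defs)
  have RC: "rarr s ''R'' = R" "rarr s ''c'' = C" using input by (simp_all add: holds_input_def)
  have "stack_state (run stack_step s) \<and>
    2 * (efforts p + 1 - nvar (run stack_step s) ''i'') + nvar (run stack_step s) ''k''
      < 2 * (efforts p + 1 - i) + k"
  proof (cases "B k < x")
    case True
    then show ?thesis
      using stack_push[OF inv i x_def True] input i
      by (simp add: stack_state_def stack_step_def holds_input_def RC x_def flip: defs)
  next
    case False
    then show ?thesis
      using stack_pop[OF inv i x_def False] input
      by (simp add: stack_state_def stack_step_def holds_input_def RC x_def flip: defs)
  qed
  then show "stack_state (run stack_step s)"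
    "2 * (efforts p + 1 - nvar (run stack_step s) ''i'') + nvar (run stack_step s) ''k''
      < 2 * (efforts p + 1 - nvar s ''i'') + nvar s ''k''"
    by (simp_all flip: defs)
qed

lemma stack_loop_correct:
  "halts stack_state (While stack_guard stack_step)
     ((1 + btime stack_guard + time_bound stack_step) * (2 * efforts p + 1))
     (\<lambda>s. stack_state s \<and> \<not> bval stack_guard s)"
proof (rule halts_While[where m = "\<lambda>s. 2 * (efforts p + 1 - nvar s ''i'') + nvar s ''k''"])
  fix s assume "stack_state s"
  then have "stack_inv (nvar s ''i'') (nvar s ''k'') (narr s ''S'') (rarr s ''B'')"
    by (simp add: stack_state_def)
  then have "nvar s ''k'' < nvar s ''i''" "nvar s ''i'' \<le> efforts p + 1"
    by (rule stack_size, simp add: stack_inv_def)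
  then show "2 * (efforts p + 1 - nvar s ''i'') + nvar s ''k'' \<le> 2 * efforts p" by simp
qed (use loop_free_parts stack_step_correct in auto)

lemma init_sweep_correct:
  "halts (\<lambda>s. stack_state s \<and> \<not> bval stack_guard s) init_sweep (time_bound init_sweep) sweep_state"
proof (rule halts_loop_free)
  fix s assume s: "stack_state s \<and> \<not> bval stack_guard s"
  let ?k = "nvar s ''k''" and ?S = "narr s ''S''" and ?B = "rarr s ''B''"
  let ?B' = "?B(Suc ?k := ?B ?k + 2)"
  have env: "contract_envelope p ?k ?S ?B'"
    using s stack_final by (auto simp: stack_state_def stack_guard_def holds_input_def)
  show "sweep_state (run init_sweep s)"
    using s env contract_envelope.sweep_init[OF env]
    by (simp add: sweep_state_def stack_state_def holds_input_def init_sweep_def)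
qed (simp add: loop_free_parts)

end

context contract_envelope
begin

text \<open>The cached scalars describe the cell of \<open>a\<close> and \<open>b\<close>, while the
  index variables already point to the next cell.\<close>

lemma run_sweep_upper_lower:
  assumes "holds_input s" "nvar s ''k'' = k" "narr s ''S'' = S" "rarr s ''B'' = B"
    "nvar s ''a'' = a" "nvar s ''b'' = b"
  shows "holds_input (run sweep_upper (run sweep_lower s))"
    "nvar (run sweep_upper (run sweep_lower s)) ''k'' = k" "narr (run sweep_upper (run sweep_lower s)) = narr s"
    "rarr (run sweep_upper (run sweep_lower s)) = rarr s"
    "(nvar (run sweep_upper (run sweep_lower s)) ''a'', nvar (run sweep_upper (run sweep_lower s)) ''b'') = next_cell a b"
    "x \<in> {''gamma'', ''beta'', ''best''} \<Longrightarrow> rvar (run sweep_upper (run sweep_lower s)) x = rvar s x"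
    "rvar (run sweep_upper (run sweep_lower s)) ''ra'' = R (S a)" "rvar (run sweep_upper (run sweep_lower s)) ''rb'' = R (S b)"
    "rvar (run sweep_upper (run sweep_lower s)) ''ca'' = C (S a)" "rvar (run sweep_upper (run sweep_lower s)) ''cb'' = C (S b)"
    "rvar (run sweep_upper (run sweep_lower s)) ''lo'' = cell_lo a b"
    "rvar (run sweep_upper (run sweep_lower s)) ''hi'' = cell_hi a b"
proof -
  have RC: "rarr s ''R'' = R" "rarr s ''c'' = C" "rvar s ''kappaS'' = kappaS p"
    using assms(1) by (simp_all add: holds_input_def)
  note eqs = run_sweep_lower[where s = s] run_sweep_upper[where s = "run sweep_lower s"]
  show "holds_input (run sweep_upper (run sweep_lower s))"
    using assms(1) by (simp add: holds_input_def eqs)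
  show "nvar (run sweep_upper (run sweep_lower s)) ''k'' = k"
    "narr (run sweep_upper (run sweep_lower s)) = narr s"
    "rarr (run sweep_upper (run sweep_lower s)) = rarr s"
    using assms(2) by (simp_all add: eqs)
  show "x \<in> {''gamma'', ''beta'', ''best''} \<Longrightarrow>
      rvar (run sweep_upper (run sweep_lower s)) x = rvar s x"
    by (auto simp: eqs)
  show "rvar (run sweep_upper (run sweep_lower s)) ''ra'' = R (S a)"
    "rvar (run sweep_upper (run sweep_lower s)) ''rb'' = R (S b)"
    "rvar (run sweep_upper (run sweep_lower s)) ''ca'' = C (S a)"
    "rvar (run sweep_upper (run sweep_lower s)) ''cb'' = C (S b)"
    "rvar (run sweep_upper (run sweep_lower s)) ''lo'' = cell_lo a b"
    using assms by (simp_all add: eqs RC cell_lo_def line_def)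
  show "(nvar (run sweep_upper (run sweep_lower s)) ''a'',
      nvar (run sweep_upper (run sweep_lower s)) ''b'') = next_cell a b"
    "rvar (run sweep_upper (run sweep_lower s)) ''hi'' = cell_hi a b"
    unfolding eqs using assms by (simp_all add: eqs RC next_cell_def cell_hi_def cell_end_def line_def)
qed

end

context contract_problem
begin

lemma sweep_step_correct:
  assumes "sweep_state s" "bval sweep_guard s"
  shows "sweep_state (run sweep_step s)"
    "2 * nvar (run sweep_step s) ''k'' + 2 - (nvar (run sweep_step s) ''a'' + nvar (run sweep_step s) ''b'')
      < 2 * nvar s ''k'' + 2 - (nvar s ''a'' + nvar s ''b'')"
proof -
  define k S B a b where "k = nvar s ''k''" and "S = narr s ''S''" and "B = rarr s ''B''"
    and "a = nvar s ''a''" and "b = nvar s ''b''"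
  note defs = this
  define s1 where "s1 = run sweep_upper (run sweep_lower s)"
  define s2 where "s2 = run sweep_share s1"
  define s3 where "s3 = run sweep_inspection s2"
  define s4 where "s4 = run sweep_step s"
  have input: "holds_input s" and env: "contract_envelope p k S B"
    using assms(1) by (simp_all add: sweep_state_def defs)
  interpret contract_envelope p k S B by (rule env)
  have inv: "sweep_inv a b (rvar s ''gamma'') (rvar s ''beta'') (rvar s ''best'')"
    using assms(1) by (simp add: sweep_state_def defs)
  have a: "a < k + 1" using assms(2) by (simp add: sweep_guard_def defs)
  note s1 = run_sweep_upper_lower[where s = s, OF input defs[symmetric], folded s1_def]
  have s1_input: "rvar s1 ''kappaS'' = kappaS p" "rvar s1 ''kappaI'' = kappaI p"
    "1 - rvar s1 ''alpha'' = w"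
    using s1(1) by (simp_all add: holds_input_def w_def)
  define lo hi where "lo = cell_lo a b" and "hi = cell_hi a b"
  define g where "g = cell_share a b lo hi"
  define y where "y = cell_inspection a b g"
  define u where "u = (1 - g) * R (S a) - y * kappaI p"
  note s2 = run_sweep_share[where s = s1, folded s2_def]
  note s3 = run_sweep_inspection[where s = s2, folded s3_def]
  note s4 = run_sweep_update[where s = s3]
  have g: "rvar s2 ''g'' = g"
    by (simp add: s2 s1 s1_input g_def cell_share_def lo_def hi_def)
  have y: "rvar s3 ''y'' = y"
    by (simp add: s3 g) (simp add: s2 s1 s1_input y_def cell_inspection_def threshold_def)
  have u: "rvar s3 ''u'' = u"
    unfolding s3(6) g y by (simp add: s2 s1 s1_input u_def)
  have run: "s4 = (if hi < lo then s1 else run sweep_update s3)"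
    by (simp add: s4_def sweep_step_def s1 s2_def s3_def lo_def hi_def flip: s1_def)
  have frame: "nvar s4 = nvar s1" "narr s4 = narr s1" "rarr s4 = rarr s1"
    "rvar s4 ''kappaS'' = kappaS p" "rvar s4 ''kappaI'' = kappaI p" "rvar s4 ''alpha'' = alpha p"
    using s1(1) by (simp_all add: run s4 s3 s2 holds_input_def)
  have upd: "(rvar s4 ''gamma'', rvar s4 ''beta'', rvar s4 ''best'') =
    (if lo \<le> hi \<and> rvar s ''best'' < u then (g, y, u)
     else (rvar s ''gamma'', rvar s ''beta'', rvar s ''best''))"
  proof (cases "hi < lo")
    case True
    then show ?thesis by (simp add: run s1(6))
  next
    case False
    have "rvar s3 ''g'' = g" "rvar s3 ''best'' = rvar s ''best''"
      "rvar s3 ''gamma'' = rvar s ''gamma''" "rvar s3 ''beta'' = rvar s ''beta''"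
      by (simp_all add: s3 g) (simp_all add: s2 s1)
    with False show ?thesis
      using s4(5) by (simp add: run y u not_less)
  qed
  obtain a' b' where n: "next_cell a b = (a', b')" by (cases "next_cell a b")
  then have ab': "nvar s1 ''a'' = a'" "nvar s1 ''b'' = b'" using s1(5) by simp_all
  have "sweep_inv a' b' (rvar s4 ''gamma'') (rvar s4 ''beta'') (rvar s4 ''best'')"
    by (rule sweep_next[OF inv a n lo_def hi_def g_def y_def u_def upd])
  moreover have "holds_input s4"
    using s1(1) by (simp add: holds_input_def frame)
  ultimately show "sweep_state (run sweep_step s)"
    using env s1(2) unfolding s4_def[symmetric]
    by (simp add: sweep_state_def ab' frame s1(3,4) defs)
  \<comment> \<open>With the guard, this keeps the truncated subtraction positive, so the single
    pointer move strictly lowers the measure.\<close>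
  have "b \<le> k" using inv by (simp add: sweep_inv_def)
  moreover have "a' + b' = Suc (a + b)" using n by (auto simp: next_cell_def split: if_splits)
  ultimately have "2 * k + 2 - (a' + b') < 2 * k + 2 - (a + b)" using a by simp
  then show "2 * nvar (run sweep_step s) ''k'' + 2 -
      (nvar (run sweep_step s) ''a'' + nvar (run sweep_step s) ''b'')
      < 2 * nvar s ''k'' + 2 - (nvar s ''a'' + nvar s ''b'')"
    unfolding s4_def[symmetric] using s1(2) by (simp add: ab' frame flip: defs)
qed

lemma sweep_loop_correct:
  "halts sweep_state (While sweep_guard sweep_step)
     ((1 + btime sweep_guard + time_bound sweep_step) * (2 * efforts p + 1))
     (\<lambda>s. optimal_linear_contract p (output_contract s))"
proof -
  have "halts sweep_state (While sweep_guard sweep_step)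
     ((1 + btime sweep_guard + time_bound sweep_step) * (2 * efforts p + 1))
     (\<lambda>s. sweep_state s \<and> \<not> bval sweep_guard s)"
  proof (rule halts_While[where m = "\<lambda>s. 2 * nvar s ''k'' + 2 - (nvar s ''a'' + nvar s ''b'')"])
    fix s assume s: "sweep_state s"
    then interpret contract_envelope p "nvar s ''k''" "narr s ''S''" "rarr s ''B''"
      by (simp add: sweep_state_def)
    have "1 \<le> nvar s ''a''" "1 \<le> nvar s ''b''"
      using s by (auto simp: sweep_state_def sweep_inv_def)
    moreover have "nvar s ''k'' \<le> efforts p" by (rule size)
    ultimately show "2 * nvar s ''k'' + 2 - (nvar s ''a'' + nvar s ''b'') \<le> 2 * efforts p" by simp
  qed (use sweep_step_correct loop_free_parts in auto)
  moreover have "optimal_linear_contract p (output_contract s)"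
    if "sweep_state s \<and> \<not> bval sweep_guard s" for s
  proof -
    interpret contract_envelope p "nvar s ''k''" "narr s ''S''" "rarr s ''B''"
      using that by (simp add: sweep_state_def)
    show ?thesis
      using that sweep_final by (auto simp: sweep_state_def sweep_guard_def output_contract_def)
  qed
  ultimately show ?thesis unfolding halts_def by blast
qed

end

section \<open>Total running time and existence of the algorithm\<close>

definition prog_time :: "nat \<Rightarrow> nat" where
  "prog_time n =
     time_bound init_stack + ((1 + btime stack_guard + time_bound stack_step) * (2 * n + 1) +
     (time_bound init_sweep + (1 + btime sweep_guard + time_bound sweep_step) * (2 * n + 1)))"

text \<open>The bound is even linear in \<open>n\<close>. That \<open>ln\<close> vanishes at 1 is
  harmless, as the Landau symbol concerns large \<open>n\<close> only.\<close>

lemma prog_time_bigo: "(\<lambda>n. real (prog_time n)) \<in> O(\<lambda>n. real n * ln (real n))"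
proof -
  have lin: "(\<lambda>n. 2 * real n + 1) \<in> O(\<lambda>n. real n * ln (real n))"
    and const: "(\<lambda>n. c) \<in> O(\<lambda>n. real n * ln (real n))" for c :: real
    by real_asymp+
  have "(\<lambda>n. K * (2 * real n + 1)) \<in> O(\<lambda>n. real n * ln (real n))" for K
    using lin by (simp del: mult_Suc_right)
  then have "(\<lambda>n. c + (K * (2 * real n + 1) + (c' + K' * (2 * real n + 1))))
      \<in> O(\<lambda>n. real n * ln (real n))" for c c' K K'
    by (intro sum_in_bigo const)
  moreover have "real (prog_time n) = real (time_bound init_stack) +
    (real (1 + btime stack_guard + time_bound stack_step) * (2 * real n + 1) +
    (real (time_bound init_sweep) +
     real (1 + btime sweep_guard + time_bound sweep_step) * (2 * real n + 1)))" for n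
    unfolding prog_time_def of_nat_add of_nat_mult by simp
  ultimately show ?thesis by presburger
qed

theorem theorem1:
  shows "\<exists>(prog :: com) (T :: nat \<Rightarrow> real).
    T \<in> O(\<lambda>n. real n * ln (real n)) \<and>
    (\<forall>p :: problem.
       valid_problem p \<longrightarrow> increasing_costs_rewards p \<longrightarrow> safety_worthwhile p \<longrightarrow>
       (\<exists>t s. exec prog (input_state p) t s \<and> real t \<le> T (efforts p) \<and>
              optimal_linear_contract p (output_contract s)))"
proof (rule exI[of _ contract_prog], rule exI[of _ "\<lambda>n. real (prog_time n)"],
    intro conjI allI impI)
  show "(\<lambda>n. real (prog_time n)) \<in> O(\<lambda>n. real n * ln (real n))" by (rule prog_time_bigo)
next
  fix p assume "valid_problem p" "increasing_costs_rewards p" "safety_worthwhile p"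
  then interpret contract_problem p by unfold_locales
  have "halts (\<lambda>s. s = input_state p) contract_prog (prog_time (efforts p))
      (\<lambda>s. optimal_linear_contract p (output_contract s))"
    unfolding contract_prog_def prog_time_def
    by (rule halts_Seq[OF init_stack_correct halts_Seq[OF stack_loop_correct
        halts_Seq[OF init_sweep_correct sweep_loop_correct]]])
  then obtain t s where "exec contract_prog (input_state p) t s" "t \<le> prog_time (efforts p)"
    "optimal_linear_contract p (output_contract s)"
    unfolding halts_def by blast
  then show "\<exists>t s. exec contract_prog (input_state p) t s \<and> real t \<le> real (prog_time (efforts p)) \<and>
      optimal_linear_contract p (output_contract s)"
    using of_nat_le_iff by blast
qed

end
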